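(* Let $V=(V,\alpha)\in\mathcal{P}$. Then one of the following alternatives is satisfied: (1) $c(V)=4\sqrt{2V_{\min}}/(2-\alpha)$, and it is achieved by the juxtaposition of two homothetic motions, the first connecting $\xi^-$ to the origin and the second connecting the origin to $\xi^+$; (2) $c(V)<4\sqrt{2V_{\min}}/(2-\alpha)$, and it is achieved by trajectories which are uniformly bounded away from the origin, i.e. $c(V)$ is achieved and there exists a ball $B$ centered at the origin such that no trajectory achieving $c(V)$ intersects $B$.
   Context: Let $d\ge 2$ and let $\mathbb{S}^{d-1}$ be the unit sphere of $\mathbb{R}^d$. Fix $\xi^+\neq\xi^-$ in $\mathbb{S}^{d-1}$ and a real number $V_{\min}>0$. Let $\mathcal{S}$ be the set of $V\in C^2(\mathbb{S}^{d-1})$ such that $V(s)\ge V(\xi^\pm)=V_{\min}$ for all $s\in\mathbb{S}^{d-1}$ and there exist $\delta>0$, $\mu>0$ such that $|s-\xi^\pm|<\delta$ implies $V(s)-V(\xi^\pm)\ge\mu|s-\xi^\pm|^2$ (for $s\in\mathbb{S}^{d-1}$). Let $\mathcal{P}=\{(V,\alpha)\in C^2(\mathbb{S}^{d-1})\times(0,2): V\in\mathcal{S}\}$. An element $(V,\alpha)\in\mathcal{P}$ is identified with the potential $V(x)=V(x/|x|)/|x|^\alpha$ on $\mathbb{R}^d\setminus\{0\}$ (with value $+\infty$ at $0$), and is often denoted simply by $V$. For $a<b$ and $x\in H^1((a,b);\mathbb{R}^d)$ the (possibly infinite) action is $\mathcal{A}([a,b];x)=\int_a^b\left(\frac12|\dot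 x|^2+V(x)\right)dt$; the action may be finite even if $x$ passes through the origin. Define $c(V)=\inf\{\mathcal{A}([a,b];x): a<b,\ x\in H^1((a,b);\mathbb{R}^d),\ x(a)=\xi^-,\ x(b)=\xi^+\}$. A trajectory achieves $c(V)$ if it is admissible in this infimum and its action equals $c(V)$. A homothetic motion is a trajectory with constant angular part $x/|x|$. *)

theory Defs
  imports "HOL-Analysis.Analysis"
begin

definition C2_on :: "'a::euclidean_space set \<Rightarrow> ('a \<Rightarrow> real) \<Rightarrow> bool" where
  "C2_on U g \<longleftrightarrow>
     (\<exists>(g' :: 'a \<Rightarrow> 'a \<Rightarrow>\<^sub>L real) (g'' :: 'a \<Rightarrow> 'a \<Rightarrow>\<^sub>L 'a \<Rightarrow>\<^sub>L real).
        (\<forall>x\<in>U. (g has_derivative blinfun_apply (g' x)) (at x)) \<and>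
        (\<forall>x\<in>U. (g' has_derivative blinfun_apply (g'' x)) (at x)) \<and>
        continuous_on U g'')"

text \<open>
  A function on the unit sphere is of class C2 if near each point of the sphere it is the
  restriction of a C2 function on an open subset of the ambient space. Here and below a function
  on the sphere is a total function of which only the values on \<^term>\<open>sphere 0 1\<close> matter.
\<close>

definition C2_on_sphere :: "('a::euclidean_space \<Rightarrow> real) \<Rightarrow> bool" where
  "C2_on_sphere V \<longleftrightarrow>
     (\<forall>p\<in>sphere 0 1. \<exists>U g. open U \<and> p \<in> U \<and> C2_on U g \<and> (\<forall>s\<in>U \<inter> sphere 0 1. V s = g s))"

definition quadratic_growth_at :: "'a::euclidean_space \<Rightarrow> ('a \<Rightarrow> real) \<Rightarrow> bool" where
  "quadratic_growth_at \<xi> V \<longleftrightarrow>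
     (\<exists>\<delta>>0. \<exists>\<mu>>0. \<forall>s\<in>sphere 0 1. norm (s - \<xi>) < \<delta> \<longrightarrow> V s - V \<xi> \<ge> \<mu> * (norm (s - \<xi>))\<^sup>2)"

definition class_S :: "'a::euclidean_space \<Rightarrow> 'a \<Rightarrow> real \<Rightarrow> ('a \<Rightarrow> real) set" where
  "class_S \<xi>m \<xi>p Vmin =
     {V. C2_on_sphere V \<and> V \<xi>m = Vmin \<and> V \<xi>p = Vmin \<and> (\<forall>s\<in>sphere 0 1. V s \<ge> Vmin) \<and>
         quadratic_growth_at \<xi>m V \<and> quadratic_growth_at \<xi>p V}"

definition class_P :: "'a::euclidean_space \<Rightarrow> 'a \<Rightarrow> real \<Rightarrow> (('a \<Rightarrow> real) \<times> real) set" where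
  "class_P \<xi>m \<xi>p Vmin = {(V, \<alpha>). 0 < \<alpha> \<and> \<alpha> < 2 \<and> V \<in> class_S \<xi>m \<xi>p Vmin}"

text \<open>
  The homogeneous potential takes values in \<^typ>\<open>ennreal\<close>, so that it is infinite at the
  origin. For elements of \<^const>\<open>class_P\<close> with \<open>Vmin > 0\<close> the function \<open>V\<close> is
  positive on the sphere, hence \<^const>\<open>ennreal\<close> does not truncate.
\<close>

definition potential :: "('a::euclidean_space \<Rightarrow> real) \<times> real \<Rightarrow> 'a \<Rightarrow> ennreal" where
  "potential P x =
     (if x = 0 then \<infinity> else ennreal (fst P (x /\<^sub>R norm x) / (norm x powr snd P)))"

definition test_function :: "real \<Rightarrow> real \<Rightarrow> (real \<Rightarrow> real) \<Rightarrow> (real \<Rightarrow> real) \<Rightarrow> bool" where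
  "test_function a b \<phi> \<phi>' \<longleftrightarrow>
     (\<forall>t. (\<phi> has_real_derivative \<phi>' t) (at t)) \<and> continuous_on UNIV \<phi>' \<and>
     (\<exists>K. compact K \<and> K \<subseteq> {a<..<b} \<and> (\<forall>t. t \<notin> K \<longrightarrow> \<phi> t = 0))"

definition square_integrable :: "real \<Rightarrow> real \<Rightarrow> (real \<Rightarrow> 'a::euclidean_space) \<Rightarrow> bool" where
  "square_integrable a b f \<longleftrightarrow>
     set_borel_measurable lborel {a<..<b} f \<and>
     set_integrable lborel {a<..<b} (\<lambda>t. (norm (f t))\<^sup>2)"

definition has_weak_derivative ::
    "real \<Rightarrow> real \<Rightarrow> (real \<Rightarrow> 'a::euclidean_space) \<Rightarrow> (real \<Rightarrow> 'a) \<Rightarrow> bool" where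
  "has_weak_derivative a b x v \<longleftrightarrow>
     (\<forall>\<phi> \<phi>'. test_function a b \<phi> \<phi>' \<longrightarrow>
        set_lebesgue_integral lborel {a<..<b} (\<lambda>t. \<phi>' t *\<^sub>R x t) =
        - set_lebesgue_integral lborel {a<..<b} (\<lambda>t. \<phi> t *\<^sub>R v t))"

text \<open>
  An element of the Sobolev space H1 on \<open>(a, b)\<close> is represented by its unique representative
  that is continuous on \<open>[a, b]\<close>; only the values on \<open>[a, b]\<close> matter. This
  representative gives meaning to the endpoint conditions and to passing through the origin.
\<close>

definition H1 :: "real \<Rightarrow> real \<Rightarrow> (real \<Rightarrow> 'a::euclidean_space) set" where
  "H1 a b =
     {x. continuous_on {a..b} x \<and> square_integrable a b x \<and>
         (\<exists>v. square_integrable a b v \<and> has_weak_derivative a b x v)}"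

text \<open>The weak derivative is unique up to a null set, so the choice is immaterial in the action.\<close>

definition weak_derivative :: "real \<Rightarrow> real \<Rightarrow> (real \<Rightarrow> 'a::euclidean_space) \<Rightarrow> real \<Rightarrow> 'a" where
  "weak_derivative a b x = (SOME v. square_integrable a b v \<and> has_weak_derivative a b x v)"

definition action ::
    "('a::euclidean_space \<Rightarrow> real) \<times> real \<Rightarrow> real \<Rightarrow> real \<Rightarrow> (real \<Rightarrow> 'a) \<Rightarrow> ennreal" where
  "action P a b x =
     (\<integral>\<^sup>+ t \<in> {a<..<b}. (ennreal ((norm (weak_derivative a b x t))\<^sup>2 / 2) + potential P (x t)) \<partial>lborel)"

definition admissible ::
    "'a::euclidean_space \<Rightarrow> 'a \<Rightarrow> real \<Rightarrow> real \<Rightarrow> (real \<Rightarrow> 'a) \<Rightarrow> bool" where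
  "admissible \<xi>m \<xi>p a b x \<longleftrightarrow> a < b \<and> x \<in> H1 a b \<and> x a = \<xi>m \<and> x b = \<xi>p"

definition min_action ::
    "'a::euclidean_space \<Rightarrow> 'a \<Rightarrow> ('a \<Rightarrow> real) \<times> real \<Rightarrow> ennreal" where
  "min_action \<xi>m \<xi>p P = Inf {action P a b x | a b x. admissible \<xi>m \<xi>p a b x}"

definition achieves_min ::
    "'a::euclidean_space \<Rightarrow> 'a \<Rightarrow> ('a \<Rightarrow> real) \<times> real \<Rightarrow> real \<Rightarrow> real \<Rightarrow> (real \<Rightarrow> 'a) \<Rightarrow> bool" where
  "achieves_min \<xi>m \<xi>p P a b x \<longleftrightarrow> admissible \<xi>m \<xi>p a b x \<and> action P a b x = min_action \<xi>m \<xi>p P"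

text \<open>
  Endpoints are excluded from the condition on the angular part, as a homothetic motion may
  start or end at the origin.
\<close>

definition homothetic_motion :: "real \<Rightarrow> real \<Rightarrow> (real \<Rightarrow> 'a::euclidean_space) \<Rightarrow> bool" where
  "homothetic_motion a b x \<longleftrightarrow>
     a < b \<and> x \<in> H1 a b \<and> (\<exists>s. \<forall>t\<in>{a<..<b}. x t \<noteq> 0 \<and> x t /\<^sub>R norm (x t) = s)"

definition juxtaposed_homothetic ::
    "'a::euclidean_space \<Rightarrow> 'a \<Rightarrow> real \<Rightarrow> real \<Rightarrow> (real \<Rightarrow> 'a) \<Rightarrow> bool" where
  "juxtaposed_homothetic \<xi>m \<xi>p a b x \<longleftrightarrow>
     (\<exists>\<tau>. homothetic_motion a \<tau> x \<and> x a = \<xi>m \<and> x \<tau> = 0 \<and>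
          homothetic_motion \<tau> b x \<and> x b = \<xi>p)"

end

theory Submission
  imports Defs "HOL-Complex_Analysis.Great_Picard"
begin

text \<open>
  Write \<open>M\<close> for \<open>4 * sqrt (2 * Vmin) / (2 - \<alpha>)\<close>. By the arithmetic-geometric inequality the
  integrand of the action is at least \<open>f (norm x) * norm v\<close> with
  \<open>f u = sqrt (2 * Vmin) * u powr (- \<alpha> / 2)\<close>, because \<open>V \<ge> Vmin\<close> on the sphere. Let \<open>barrier\<close> be the
  antiderivative of \<open>f\<close> that vanishes at \<open>0\<close>; it is finite because \<open>\<alpha> < 2\<close>, it is unbounded for the
  same reason, and \<open>2 * barrier 1 = M\<close>. A path that leaves the unit sphere, comes down to radius \<open>r\<close>
  and returns to the unit sphere has action at least \<open>2 * (barrier 1 - barrier r)\<close>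
  (\<open>action_ge_barrier\<close>). In the limit \<open>r \<rightarrow> 0\<close> this is \<open>M\<close>, and \<open>M\<close> is attained by the radial
  motions of zero energy through \<open>\<xi>m\<close> and \<open>\<xi>p\<close>, for which both inequalities are equalities
  (\<open>homothetic_path_action\<close>). So the infimum is at most \<open>M\<close>, and equality is the first alternative.

  If the infimum lies below some \<open>C < M\<close>, then all paths of action at most \<open>C\<close> stay in one fixed
  annulus \<open>r < norm x < R\<close> (\<open>confinement\<close>). This is already the uniform distance to the origin,
  and it removes the singularity from the variational problem, so that the direct method applies
  (\<open>minimiser_exists\<close>). Minimising paths are rescaled to the time interval \<open>[0, 1]\<close>, which turns
  the duration \<open>T\<close> into a parameter of the functional
  \<open>energy / (2 * T) + T * potential part\<close>. The duration is bounded above because the potential is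
  bounded below on the annulus, and bounded below because the end points are distinct. The
  bound on the energy gives equicontinuity, hence a uniformly convergent subsequence; the potential
  part converges along it and the energy is lower semicontinuous (\<open>energy_lower_semicontinuous\<close>).

  The calculus behind both halves is the fundamental theorem
  \<open>x t - x s = integral {s..t} v\<close> for weak derivatives (\<open>weak_derivative_FTC\<close>). It makes weak
  derivatives unique almost everywhere, gives paths of bounded energy their Hoelder continuity, and
  supplies the domination by an indefinite integral on which the chain rule estimate
  \<open>chain_rule_bound\<close> rests.
\<close>

section \<open>Square integrable functions on a finite measure space\<close>

definition square_integrable_on :: "'t measure \<Rightarrow> ('t \<Rightarrow> 'a::euclidean_space) \<Rightarrow> bool" where
  "square_integrable_on M f \<longleftrightarrow> f \<in> borel_measurable M \<and> integrable M (\<lambda>t. (norm (f t))\<^sup>2)"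

lemma norm_add_sq_le: "(norm (u + v))\<^sup>2 \<le> 2 * (norm u)\<^sup>2 + 2 * (norm (v::'a::real_inner))\<^sup>2"
proof -
  have "2 * (norm u)\<^sup>2 + 2 * (norm v)\<^sup>2 - (norm (u + v))\<^sup>2 = (norm (u - v))\<^sup>2"
    by (simp add: power2_norm_eq_inner inner_simps algebra_simps inner_commute)
  then show ?thesis by (smt (verit) zero_le_power2)
qed

lemma square_integrable_on_add:
  assumes "square_integrable_on M f" "square_integrable_on M g"
  shows "square_integrable_on M (\<lambda>t. f t + g t)"
proof -
  have [measurable]: "f \<in> borel_measurable M" "g \<in> borel_measurable M"
    using assms by (auto simp: square_integrable_on_def)
  have "integrable M (\<lambda>t. 2 * (norm (f t))\<^sup>2 + 2 * (norm (g t))\<^sup>2)"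
    using assms by (auto simp: square_integrable_on_def)
  then have "integrable M (\<lambda>t. (norm (f t + g t))\<^sup>2)"
    by (rule Bochner_Integration.integrable_bound) (use norm_add_sq_le in \<open>auto\<close>)
  then show ?thesis by (simp add: square_integrable_on_def)
qed

lemma square_integrable_on_scaleR:
  assumes "square_integrable_on M f"
  shows "square_integrable_on M (\<lambda>t. c *\<^sub>R f t)"
  using assms by (auto simp: square_integrable_on_def power_mult_distrib)

lemma square_integrable_on_diff:
  assumes "square_integrable_on M f" "square_integrable_on M g"
  shows "square_integrable_on M (\<lambda>t. f t - g t)"
  using square_integrable_on_add[OF assms(1) square_integrable_on_scaleR[OF assms(2), of "-1"]]
  by simp

lemma (in finite_measure) square_integrable_imp_integrable:
  assumes "square_integrable_on M f"
  shows "integrable M f"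
proof (rule Bochner_Integration.integrable_bound)
  show "integrable M (\<lambda>t. 1 + (norm (f t))\<^sup>2)"
    using assms by (auto simp: square_integrable_on_def)
  have "norm (f t) \<le> 1 + (norm (f t))\<^sup>2" for t
    using zero_le_power2[of "norm (f t) - 1"] norm_ge_zero[of "f t"]
    unfolding power2_diff one_power2 by linarith
  then show "AE t in M. norm (f t) \<le> norm (1 + (norm (f t))\<^sup>2)" by simp
qed (use assms in \<open>simp add: square_integrable_on_def\<close>)

text \<open>
  The Cauchy-Schwarz inequality against the constant \<open>1\<close>: it says that the variance of \<open>norm f\<close> is
  nonnegative.
\<close>

lemma (in finite_measure) integral_norm_sq_le:
  assumes f: "square_integrable_on M f"
  shows "(\<integral>t. norm (f t) \<partial>M)\<^sup>2 \<le> measure M (space M) * (\<integral>t. (norm (f t))\<^sup>2 \<partial>M)"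
proof (cases "measure M (space M) = 0")
  case True
  then have "AE t in M. norm (f t) = 0"
    by (intro AE_I'[of "space M"]) (auto simp: null_sets_def emeasure_eq_measure)
  then have "(\<integral>t. norm (f t) \<partial>M) = 0" by (rule integral_eq_zero_AE)
  then show ?thesis by (simp add: True)
next
  case False
  define \<mu> where "\<mu> = measure M (space M)"
  \<comment> \<open>the mean value of \<open>norm f\<close>\<close>
  define m where "m = (\<integral>t. norm (f t) \<partial>M) / \<mu>"
  have \<mu>: "\<mu> > 0" using False by (simp add: \<mu>_def zero_less_measure_iff less_le)
  have i1: "integrable M (\<lambda>t. norm (f t))"
    using square_integrable_imp_integrable[OF f] by simp
  have i2: "integrable M (\<lambda>t. (norm (f t))\<^sup>2)" using f by (simp add: square_integrable_on_def)
  have "0 \<le> (\<integral>t. (norm (f t) - m)\<^sup>2 \<partial>M)" by simp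
  also have "\<dots> = (\<integral>t. (norm (f t))\<^sup>2 - 2 * m * norm (f t) + m\<^sup>2 \<partial>M)"
    by (intro Bochner_Integration.integral_cong refl) (simp add: power2_diff algebra_simps)
  also have "\<dots> = (\<integral>t. (norm (f t))\<^sup>2 \<partial>M) - 2 * m * (\<integral>t. norm (f t) \<partial>M) + m\<^sup>2 * \<mu>"
    using i1 i2 by (simp add: \<mu>_def mult.commute)
  also have "\<dots> = (\<integral>t. (norm (f t))\<^sup>2 \<partial>M) - (\<integral>t. norm (f t) \<partial>M)\<^sup>2 / \<mu>"
    using \<mu> by (simp add: m_def field_simps power2_eq_square)
  finally show ?thesis using \<mu> by (simp add: \<mu>_def field_simps)
qed

text \<open>
  In the form with the midpoint: two functions of nearly minimal norm in a convex set are close to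
  each other.
\<close>

lemma integral_parallelogram:
  assumes f: "square_integrable_on M f" and g: "square_integrable_on M g"
  shows "(\<integral>t. (norm (f t - g t))\<^sup>2 \<partial>M) =
    2 * (\<integral>t. (norm (f t))\<^sup>2 \<partial>M) + 2 * (\<integral>t. (norm (g t))\<^sup>2 \<partial>M)
    - 4 * (\<integral>t. (norm ((1/2) *\<^sub>R (f t + g t)))\<^sup>2 \<partial>M)"
proof -
  have i: "integrable M (\<lambda>t. (norm (f t))\<^sup>2)" "integrable M (\<lambda>t. (norm (g t))\<^sup>2)"
    "integrable M (\<lambda>t. (norm ((1/2) *\<^sub>R (f t + g t)))\<^sup>2)"
    using f g square_integrable_on_scaleR[OF square_integrable_on_add[OF f g], of "1/2"]
    unfolding square_integrable_on_def by blast+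
  have "(\<integral>t. (norm (f t - g t))\<^sup>2 \<partial>M) = (\<integral>t. 2 * (norm (f t))\<^sup>2 + 2 * (norm (g t))\<^sup>2
    - 4 * (norm ((1/2) *\<^sub>R (f t + g t)))\<^sup>2 \<partial>M)"
    by (intro Bochner_Integration.integral_cong refl)
      (simp add: power2_norm_eq_inner inner_simps algebra_simps inner_commute)
  also have "\<dots> = 2 * (\<integral>t. (norm (f t))\<^sup>2 \<partial>M) + 2 * (\<integral>t. (norm (g t))\<^sup>2 \<partial>M)
    - 4 * (\<integral>t. (norm ((1/2) *\<^sub>R (f t + g t)))\<^sup>2 \<partial>M)"
    using i by (simp del: norm_scaleR)
  finally show ?thesis .
qed

lemma square_integrable_Fatou:
  assumes u: "\<And>j. square_integrable_on M (u j)" and f[measurable]: "f \<in> borel_measurable M"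
    and lim: "AE t in M. (\<lambda>j. u j t) \<longlonglongrightarrow> f t"
    and C: "\<forall>\<^sub>F j in sequentially. (\<integral>t. (norm (u j t))\<^sup>2 \<partial>M) \<le> C"
  shows "square_integrable_on M f" "(\<integral>t. (norm (f t))\<^sup>2 \<partial>M) \<le> C"
proof -
  have [measurable]: "u j \<in> borel_measurable M" for j using u by (simp add: square_integrable_on_def)
  obtain j0 where "(\<integral>t. (norm (u j0 t))\<^sup>2 \<partial>M) \<le> C"
    using C eventually_happens trivial_limit_sequentially by blast
  then have C0: "C \<ge> 0" by (smt (verit) Bochner_Integration.integral_nonneg zero_le_power2)
  have "(\<integral>\<^sup>+t. ennreal ((norm (f t))\<^sup>2) \<partial>M)
      = (\<integral>\<^sup>+t. liminf (\<lambda>j. ennreal ((norm (u j t))\<^sup>2)) \<partial>M)"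
  proof (rule nn_integral_cong_AE, use lim in eventually_elim)
    fix t assume "(\<lambda>j. u j t) \<longlonglongrightarrow> f t"
    then have "(\<lambda>j. ennreal ((norm (u j t))\<^sup>2)) \<longlonglongrightarrow> ennreal ((norm (f t))\<^sup>2)"
      by (intro tendsto_intros) auto
    then show "ennreal ((norm (f t))\<^sup>2) = liminf (\<lambda>j. ennreal ((norm (u j t))\<^sup>2))"
      by (intro lim_imp_Liminf[symmetric]) auto
  qed
  also have "\<dots> \<le> liminf (\<lambda>j. \<integral>\<^sup>+t. ennreal ((norm (u j t))\<^sup>2) \<partial>M)"
    by (rule nn_integral_liminf) simp
  also have "\<dots> = liminf (\<lambda>j. ennreal (\<integral>t. (norm (u j t))\<^sup>2 \<partial>M))"
    using u by (simp add: nn_integral_eq_integral square_integrable_on_def)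
  also have "\<dots> \<le> liminf (\<lambda>j. ennreal C)"
    using C by (intro Liminf_mono) (auto elim!: eventually_mono intro: ennreal_leI)
  finally have le: "(\<integral>\<^sup>+t. ennreal ((norm (f t))\<^sup>2) \<partial>M) \<le> ennreal C"
    by (simp add: Liminf_const)
  then have "integrable M (\<lambda>t. (norm (f t))\<^sup>2)"
    by (intro integrableI_bounded) (auto simp: le_less_trans[OF le])
  then show "square_integrable_on M f" by (simp add: square_integrable_on_def)
  then show "(\<integral>t. (norm (f t))\<^sup>2 \<partial>M) \<le> C"
    using le C0 by (simp add: nn_integral_eq_integral square_integrable_on_def)
qed

text \<open>
  Riesz-Fischer. On a finite measure space a Cauchy sequence in quadratic mean is Cauchy in mean, so a
  subsequence converges almost everywhere, and Fatou's lemma transfers both the smallness of the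
  differences and every eventual bound on the norms to the pointwise limit.
\<close>

lemma (in finite_measure) square_integrable_complete:
  fixes w :: "nat \<Rightarrow> 'a \<Rightarrow> 'b::euclidean_space"
  assumes w: "\<And>n. square_integrable_on M (w n)"
    and cauchy: "\<And>e. e > 0 \<Longrightarrow> \<exists>N. \<forall>i\<ge>N. \<forall>j\<ge>N. (\<integral>t. (norm (w i t - w j t))\<^sup>2 \<partial>M) \<le> e"
  obtains f where "square_integrable_on M f"
    "(\<lambda>n. \<integral>t. (norm (w n t - f t))\<^sup>2 \<partial>M) \<longlonglongrightarrow> 0"
    "\<And>C. \<forall>\<^sub>F n in sequentially. (\<integral>t. (norm (w n t))\<^sup>2 \<partial>M) \<le> C \<Longrightarrow> (\<integral>t. (norm (f t))\<^sup>2 \<partial>M) \<le> C"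
proof -
  have [measurable]: "w n \<in> borel_measurable M" for n using w by (simp add: square_integrable_on_def)
  define \<mu> where "\<mu> = measure M (space M) + 1"
  have \<mu>: "\<mu> > 0" by (simp add: \<mu>_def add_nonneg_pos)
  have "\<exists>N. \<forall>i\<ge>N. \<forall>j\<ge>N. (\<integral>t. norm (w i t - w j t) \<partial>M) < e" if e: "e > 0" for e
  proof -
    obtain N where N: "\<forall>i\<ge>N. \<forall>j\<ge>N. (\<integral>t. (norm (w i t - w j t))\<^sup>2 \<partial>M) \<le> e\<^sup>2 / (2 * \<mu>)"
      using cauchy[of "e\<^sup>2 / (2 * \<mu>)"] \<mu> e by auto
    have "(\<integral>t. norm (w i t - w j t) \<partial>M) < e" if ij: "i \<ge> N" "j \<ge> N" for i j
    proof -
      have "(\<integral>t. norm (w i t - w j t) \<partial>M)\<^sup>2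
          \<le> measure M (space M) * (\<integral>t. (norm (w i t - w j t))\<^sup>2 \<partial>M)"
        by (rule integral_norm_sq_le[OF square_integrable_on_diff[OF w w]])
      also have "\<dots> \<le> \<mu> * (e\<^sup>2 / (2 * \<mu>))"
        using N ij \<mu> by (intro mult_mono) (auto simp: \<mu>_def)
      also have "\<dots> < e\<^sup>2" using \<mu> \<open>e > 0\<close> by simp
      finally show ?thesis using \<open>e > 0\<close> by (simp add: power2_less_imp_less)
    qed
    then show ?thesis by blast
  qed
  then obtain r where r: "strict_mono r" "AE t in M. Cauchy (\<lambda>i. w (r i) t)"
    using cauchy_L1_AE_cauchy_subseq[of M w] square_integrable_imp_integrable[OF w] by metis
  define f where "f t = lim (\<lambda>i. w (r i) t)" for t
  have f[measurable]: "f \<in> borel_measurable M"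
    unfolding f_def by (rule borel_measurable_lim_metric) simp
  have lim: "AE t in M. (\<lambda>i. w (r i) t) \<longlonglongrightarrow> f t"
    using r(2) by eventually_elim (simp add: f_def Cauchy_convergent convergent_LIMSEQ_iff[symmetric])
  have r_ev: "\<forall>\<^sub>F i in sequentially. P (r i)" if "\<forall>\<^sub>F n in sequentially. P n" for P
    using that r(1) eventually_subseq by blast
  have small: "\<exists>N. \<forall>n\<ge>N. square_integrable_on M (\<lambda>t. w n t - f t) \<and>
     (\<integral>t. (norm (w n t - f t))\<^sup>2 \<partial>M) \<le> e" if e: "e > 0" for e
  proof -
    obtain N where N: "\<forall>i\<ge>N. \<forall>j\<ge>N. (\<integral>t. (norm (w i t - w j t))\<^sup>2 \<partial>M) \<le> e"
      using cauchy[OF e] by blast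
    have "square_integrable_on M (\<lambda>t. w n t - f t) \<and> (\<integral>t. (norm (w n t - f t))\<^sup>2 \<partial>M) \<le> e"
      if n: "n \<ge> N" for n
    proof -
      have 1: "square_integrable_on M (\<lambda>t. w n t - w (r i) t)" for i
        by (rule square_integrable_on_diff[OF w w])
      have 2: "AE t in M. (\<lambda>i. w n t - w (r i) t) \<longlonglongrightarrow> w n t - f t"
        using lim by eventually_elim (intro tendsto_intros)
      have 3: "\<forall>\<^sub>F i in sequentially. (\<integral>t. (norm (w n t - w (r i) t))\<^sup>2 \<partial>M) \<le> e"
        using N n by (intro r_ev) (auto simp: eventually_sequentially)
      show ?thesis using square_integrable_Fatou[OF 1 _ 2 3] by simp
    qed
    then show ?thesis by blast
  qed
  obtain N where "square_integrable_on M (\<lambda>t. w N t - f t)" using small[of 1] by auto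
  from square_integrable_on_diff[OF w[of N] this] have f2: "square_integrable_on M f" by simp
  show ?thesis
  proof
    show "square_integrable_on M f" by (rule f2)
    show "(\<lambda>n. \<integral>t. (norm (w n t - f t))\<^sup>2 \<partial>M) \<longlonglongrightarrow> 0"
    proof (rule LIMSEQ_I)
      fix e :: real assume "e > 0"
      then obtain N where "\<forall>n\<ge>N. (\<integral>t. (norm (w n t - f t))\<^sup>2 \<partial>M) \<le> e/2" using small[of "e/2"] by auto
      then show "\<exists>N. \<forall>n\<ge>N. norm ((\<integral>t. (norm (w n t - f t))\<^sup>2 \<partial>M) - 0) < e"
        using \<open>e > 0\<close> by (intro exI[of _ N]) (auto intro: le_less_trans)
    qed
    show "(\<integral>t. (norm (f t))\<^sup>2 \<partial>M) \<le> C"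
      if "\<forall>\<^sub>F n in sequentially. (\<integral>t. (norm (w n t))\<^sup>2 \<partial>M) \<le> C" for C
      by (rule square_integrable_Fatou(2)[OF w f lim]) (rule r_ev[OF that])
  qed
qed

section \<open>Open intervals as measure spaces\<close>

abbreviation interval_measure :: "real \<Rightarrow> real \<Rightarrow> real measure" where
  "interval_measure a b \<equiv> restrict_space lborel {a<..<b}"

lemma finite_measure_interval: "finite_measure (interval_measure a b)"
  by (rule finite_measureI, cases "a \<le> b") (simp_all add: emeasure_restrict_space space_restrict_space)

lemma measure_interval: "a \<le> b \<Longrightarrow> measure (interval_measure a b) (space (interval_measure a b)) = b - a"
  by (simp add: measure_restrict_space space_restrict_space)

lemma square_integrable_iff:
  "square_integrable a b f \<longleftrightarrow> square_integrable_on (interval_measure a b) f"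
  unfolding square_integrable_def square_integrable_on_def set_borel_measurable_def set_integrable_def
  by (simp add: borel_measurable_restrict_space_iff integrable_restrict_space)

lemma set_lebesgue_integral_interval:
  fixes f :: "real \<Rightarrow> 'a::euclidean_space"
  shows "set_lebesgue_integral lborel {a<..<b} f = integral\<^sup>L (interval_measure a b) f"
  unfolding set_lebesgue_integral_def by (simp add: integral_restrict_space)

lemma set_integrable_interval:
  fixes f :: "real \<Rightarrow> 'a::euclidean_space"
  shows "set_integrable lborel {a<..<b} f \<longleftrightarrow> integrable (interval_measure a b) f"
  unfolding set_integrable_def by (simp add: integrable_restrict_space)

lemma square_integrable_subinterval:
  assumes "square_integrable a b f" "a \<le> s" "t \<le> b"
  shows "square_integrable s t f"
proof -
  have sub: "{s<..<t} \<subseteq> {a<..<b}" using assms by auto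
  have "set_borel_measurable lborel {s<..<t} f"
    using set_borel_measurable_subset[of lborel "{a<..<b}" f "{s<..<t}"] assms(1) sub
    by (simp add: square_integrable_def)
  moreover have "set_integrable lborel {s<..<t} (\<lambda>t. (norm (f t))\<^sup>2)"
    by (rule set_integrable_subset[of lborel "{a<..<b}"]) (use assms(1) sub in \<open>auto simp: square_integrable_def\<close>)
  ultimately show ?thesis by (simp add: square_integrable_def)
qed

lemma square_integrable_absolutely_integrable:
  fixes v :: "real \<Rightarrow> 'a::euclidean_space"
  assumes "square_integrable a b v"
  shows "v absolutely_integrable_on {a..b}"
proof -
  interpret finite_measure "interval_measure a b" by (rule finite_measure_interval)
  have "set_integrable lborel {a<..<b} v"
    using square_integrable_imp_integrable assms by (simp add: square_integrable_iff set_integrable_interval)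
  then have "v absolutely_integrable_on {a<..<b}"
    using integrable_completion[of "\<lambda>t. indicator {a<..<b} t *\<^sub>R v t" lborel] borel_measurable_integrable
    unfolding set_integrable_def by blast
  then show ?thesis by (simp add: absolutely_integrable_on_Icc_iff_Ioo)
qed

lemma integral_interval_eq:
  fixes v :: "real \<Rightarrow> 'a::euclidean_space"
  assumes "integrable (interval_measure a b) v"
  shows "integral\<^sup>L (interval_measure a b) v = integral {a..b} v"
  using set_borel_integral_eq_integral(2)[of "{a<..<b}" v] assms
  by (simp add: set_integrable_interval set_lebesgue_integral_interval integral_open_interval_real)

section \<open>The fundamental theorem of calculus for weak derivatives\<close>

text \<open>
  \<open>tent\<close> is a continuous bump on \<open>[0, 1]\<close> of total mass \<open>1\<close> and \<open>ramp\<close> is its antiderivative, which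
  climbs from \<open>0\<close> to \<open>1\<close>. Both are combinations of shifts of the positive part and of its square, so
  that the only derivative to be computed by hand is that of the square at \<open>0\<close>.
\<close>

definition hinge :: "real \<Rightarrow> real" where "hinge u = max 0 u"

definition tent :: "real \<Rightarrow> real" where
  "tent u = 4 * hinge u - 8 * hinge (u - 1/2) + 4 * hinge (u - 1)"

definition ramp :: "real \<Rightarrow> real" where
  "ramp u = 2 * (hinge u)\<^sup>2 - 4 * (hinge (u - 1/2))\<^sup>2 + 2 * (hinge (u - 1))\<^sup>2"

lemma hinge_sq_deriv: "((\<lambda>u. (hinge u)\<^sup>2) has_real_derivative 2 * hinge u) (at u)"
proof (cases "u = 0")
  case True
  have "((\<lambda>h. (hinge h)\<^sup>2 / h) \<longlongrightarrow> 0) (at 0)"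
  proof (rule Lim_null_comparison[where g="\<lambda>h. \<bar>h\<bar>"])
    show "\<forall>\<^sub>F h in at 0. norm ((hinge h)\<^sup>2 / h) \<le> \<bar>h\<bar>"
      by (rule always_eventually) (auto simp: hinge_def max_def power2_eq_square)
    show "((\<lambda>h::real. \<bar>h\<bar>) \<longlongrightarrow> 0) (at 0)" by (auto intro!: tendsto_eq_intros)
  qed
  then show ?thesis using True by (simp add: DERIV_def hinge_def)
next
  case False
  then consider "u > 0" | "u < 0" by linarith
  then show ?thesis
  proof cases
    case 1
    have "((\<lambda>u. u\<^sup>2) has_real_derivative 2 * hinge u) (at u)"
      using 1 by (auto intro!: derivative_eq_intros simp: hinge_def)
    then show ?thesis
      by (rule has_field_derivative_transform_within_open[of _ _ _ "{0<..}"])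
        (use 1 in \<open>auto simp: hinge_def\<close>)
  next
    case 2
    have "((\<lambda>u. 0) has_real_derivative 2 * hinge u) (at u)"
      using 2 by (auto intro!: derivative_eq_intros simp: hinge_def)
    then show ?thesis
      by (rule has_field_derivative_transform_within_open[of _ _ _ "{..<0}"])
        (use 2 in \<open>auto simp: hinge_def\<close>)
  qed
qed

lemma ramp_deriv: "(ramp has_real_derivative tent u) (at u)"
proof -
  have *: "((\<lambda>u. (hinge (u - c))\<^sup>2) has_real_derivative 2 * hinge (u - c)) (at u)" for c
  proof -
    have "((\<lambda>u. u - c) has_real_derivative 1) (at u)" by (auto intro!: derivative_eq_intros)
    from DERIV_chain2[where f="\<lambda>u. (hinge u)\<^sup>2", OF hinge_sq_deriv this] show ?thesis by simp
  qed
  show ?thesis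
    unfolding ramp_def tent_def
    by (rule derivative_eq_intros hinge_sq_deriv * refl)+ simp
qed

lemma continuous_tent: "continuous_on A tent"
  unfolding tent_def hinge_def by (intro continuous_intros)

lemma ramp_le: "u \<le> 0 \<Longrightarrow> ramp u = 0"
  by (simp add: ramp_def hinge_def)

lemma ramp_ge: "u \<ge> 1 \<Longrightarrow> ramp u = 1"
  by (simp add: ramp_def hinge_def power2_eq_square algebra_simps)

lemma tent_outside: "u \<le> 0 \<or> u \<ge> 1 \<Longrightarrow> tent u = 0"
  by (auto simp: tent_def hinge_def)

lemma ramp_bound: "\<bar>ramp u\<bar> \<le> 1"
proof -
  consider "u \<le> 0" | "u \<ge> 1" | "0 \<le> u" "u \<le> 1/2" | "1/2 \<le> u" "u \<le> 1" by linarith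
  then show ?thesis
  proof cases
    case 3
    then have "u\<^sup>2 \<le> (1/2)\<^sup>2" by (intro power_mono) auto
    then show ?thesis using 3 by (simp add: ramp_def hinge_def power2_eq_square)
  next
    case 4
    then have "(1 - u)\<^sup>2 \<le> (1/2)\<^sup>2" by (intro power_mono) auto
    moreover have "ramp u = 1 - 2 * (1 - u)\<^sup>2"
      using 4 by (simp add: ramp_def hinge_def power2_eq_square algebra_simps)
    ultimately show ?thesis using zero_le_power2[of "1 - u"] by (simp add: power2_eq_square)
  qed (auto simp: ramp_le ramp_ge)
qed

lemma integrable_tent: "integrable lborel tent"
  and integral_tent: "(\<integral>u. tent u \<partial>lborel) = 1"
proof -
  have ind: "(\<lambda>u. indicator {0..1} u *\<^sub>R tent u) = tent"
  proof
    show "indicator {0..1} u *\<^sub>R tent u = tent u" for u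
      by (cases "u \<le> 0 \<or> u \<ge> 1") (auto simp: indicator_def tent_outside)
  qed
  have set: "set_integrable lborel {0..1} tent"
    by (intro borel_integrable_atLeastAtMost') (rule continuous_tent)
  then show "integrable lborel tent" unfolding set_integrable_def ind .
  have "(\<integral>u. tent u \<partial>lborel) = integral {0..1} tent"
    using set_borel_integral_eq_integral(2)[OF set] unfolding set_lebesgue_integral_def ind .
  also have "\<dots> = ramp 1 - ramp 0"
    by (intro integral_unique fundamental_theorem_of_calculus)
      (auto intro!: has_field_derivative_at_within[OF ramp_deriv]
         simp: has_real_derivative_iff_has_vector_derivative[symmetric])
  finally show "(\<integral>u. tent u \<partial>lborel) = 1" by (simp add: ramp_le ramp_ge)
qed

text \<open>
  The rescaled tents form an approximate identity; the substitution \<open>t = s + u / (n + 1)\<close> moves the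
  concentration from the kernel into the argument of \<open>x\<close>, where continuity takes over.
\<close>

lemma tent_kernel_tendsto:
  fixes x :: "real \<Rightarrow> 'a::euclidean_space"
  assumes cont: "continuous_on {a..b} x" and s: "a < s" "s < b"
  shows "(\<lambda>n. \<integral>t. (real (Suc n) * tent (real (Suc n) * (t - s))) *\<^sub>R x t \<partial>interval_measure a b)
           \<longlonglongrightarrow> x s"
proof -
  define g where "g t = indicator {a<..<b} t *\<^sub>R x t" for t
  have g_meas[measurable]: "g \<in> borel_measurable borel"
  proof -
    have "(\<lambda>t. indicator {a<..<b} t *\<^sub>R x t) \<in> borel_measurable borel"
      by (rule borel_measurable_continuous_on_indicator) (use cont in \<open>auto intro: continuous_on_subset\<close>)
    then show ?thesis by (simp add: g_def[abs_def])
  qed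
  have "bounded (x ` {a..b})"
    using cont by (intro compact_imp_bounded compact_continuous_image) auto
  then obtain B where B: "\<And>t. t \<in> {a..b} \<Longrightarrow> norm (x t) \<le> B"
    unfolding bounded_iff by blast
  have gB: "norm (g t) \<le> \<bar>B\<bar>" for t
    using B[of t] by (auto simp: g_def indicator_def)
  have [measurable]: "tent \<in> borel_measurable borel"
    by (rule borel_measurable_continuous_onI) (rule continuous_tent)
  have "(\<integral>t. (real (Suc n) * tent (real (Suc n) * (t - s))) *\<^sub>R x t \<partial>interval_measure a b)
      = (\<integral>u. tent u *\<^sub>R g (s + u / real (Suc n)) \<partial>lborel)" for n
  proof -
    have "(\<integral>t. (real (Suc n) * tent (real (Suc n) * (t - s))) *\<^sub>R x t \<partial>interval_measure a b)
      = (\<integral>t. (real (Suc n) * tent (real (Suc n) * (t - s))) *\<^sub>R g t \<partial>lborel)"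
      by (subst integral_restrict_space) (auto simp: g_def scaleR_left_commute intro!: Bochner_Integration.integral_cong)
    also have "\<dots> = (1 / real (Suc n)) *\<^sub>R
        (\<integral>u. (real (Suc n) * tent (real (Suc n) * (s + u / real (Suc n) - s))) *\<^sub>R g (s + u / real (Suc n)) \<partial>lborel)"
      by (subst lborel_integral_real_affine[where c="1 / real (Suc n)" and t=s]) auto
    also have "\<dots> = (\<integral>u. tent u *\<^sub>R g (s + u / real (Suc n)) \<partial>lborel)"
    proof -
      have "(1 / N) *\<^sub>R (\<integral>u. (N * tent (N * (s + u / N - s))) *\<^sub>R g (s + u / N) \<partial>lborel)
          = (\<integral>u. tent u *\<^sub>R g (s + u / N) \<partial>lborel)" if "N > 0" for N
        using that by (subst Bochner_Integration.integral_scaleR_right[symmetric])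
          (auto intro!: Bochner_Integration.integral_cong)
      then show ?thesis by (simp del: of_nat_Suc)
    qed
    finally show ?thesis .
  qed
  moreover have "(\<lambda>n. \<integral>u. tent u *\<^sub>R g (s + u / real (Suc n)) \<partial>lborel) \<longlonglongrightarrow> (\<integral>u. tent u *\<^sub>R g s \<partial>lborel)"
  proof (rule integral_dominated_convergence[where w="\<lambda>u. \<bar>B\<bar> * \<bar>tent u\<bar>"])
    show "integrable lborel (\<lambda>u. \<bar>B\<bar> * \<bar>tent u\<bar>)" using integrable_tent by simp
    show "AE u in lborel. (\<lambda>n. tent u *\<^sub>R g (s + u / real (Suc n))) \<longlonglongrightarrow> tent u *\<^sub>R g s"
    proof (intro AE_I2 tendsto_scaleR tendsto_const)
      fix u :: real
      have "(\<lambda>n. s + u * inverse (real (Suc n))) \<longlonglongrightarrow> s + u * 0"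
        by (intro tendsto_intros LIMSEQ_inverse_real_of_nat)
      then have *: "(\<lambda>n. s + u / real (Suc n)) \<longlonglongrightarrow> s" by (simp add: divide_inverse)
      have "isCont g s"
      proof -
        have "continuous_on {a<..<b} g"
          by (rule continuous_on_eq[of _ x]) (use cont in \<open>auto simp: g_def intro: continuous_on_subset\<close>)
        then show ?thesis using s by (simp add: continuous_on_eq_continuous_at)
      qed
      then show "(\<lambda>n. g (s + u / real (Suc n))) \<longlonglongrightarrow> g s" using * isCont_tendsto_compose by blast
    qed
    show "AE u in lborel. norm (tent u *\<^sub>R g (s + u / real (Suc n))) \<le> \<bar>B\<bar> * \<bar>tent u\<bar>" for n
      by (intro AE_I2) (metis gB abs_ge_zero mult.commute mult_left_mono norm_scaleR)
  qed auto
  moreover have "(\<integral>u. tent u *\<^sub>R g s \<partial>lborel) = x s"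
    using s integrable_tent by (simp add: integral_tent g_def)
  ultimately show ?thesis by simp
qed

text \<open>
  The definition of the weak derivative is tested with the difference of two steep ramps, one rising
  at \<open>s\<close> and one at \<open>\<tau>\<close>. Its derivative concentrates at these two points, while the test function
  itself tends to the indicator of the interval between them.
\<close>

lemma weak_derivative_FTC_interior:
  fixes x :: "real \<Rightarrow> 'a::euclidean_space"
  assumes cont: "continuous_on {a..b} x" and v: "integrable (interval_measure a b) v"
    and weak: "has_weak_derivative a b x v" and st: "a < s" "s \<le> \<tau>" "\<tau> < b"
  shows "x \<tau> - x s = (\<integral>t. indicator {s<..\<tau>} t *\<^sub>R v t \<partial>interval_measure a b)"
proof -
  interpret finite_measure "interval_measure a b" by (rule finite_measure_interval)
  have [measurable]: "v \<in> borel_measurable (interval_measure a b)" using v by (rule borel_measurable_integrable)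
  have x_int: "integrable (interval_measure a b) (\<lambda>t. h t *\<^sub>R x t)" if "continuous_on UNIV h" for h
  proof -
    have "set_integrable lborel {a..b} (\<lambda>t. h t *\<^sub>R x t)"
      by (intro borel_integrable_atLeastAtMost' continuous_intros cont continuous_on_subset[OF that]) auto
    then have "set_integrable lborel {a<..<b} (\<lambda>t. h t *\<^sub>R x t)"
      by (rule set_integrable_subset) auto
    then show ?thesis by (simp add: set_integrable_interval)
  qed
  define \<phi> where "\<phi> n t = ramp (real (Suc n) * (t - s)) - ramp (real (Suc n) * (t - \<tau>))" for n t
  define \<phi>' where "\<phi>' n t = real (Suc n) * tent (real (Suc n) * (t - s))
     - real (Suc n) * tent (real (Suc n) * (t - \<tau>))" for n t
  have cont_k: "continuous_on UNIV (\<lambda>t. real (Suc n) * tent (real (Suc n) * (t - c)))" for n c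
    by (intro continuous_intros continuous_on_compose2[OF continuous_tent[of UNIV]]) auto
  have deriv: "(\<phi> n has_real_derivative \<phi>' n t) (at t)" for n t
  proof -
    have "((\<lambda>t. ramp (real (Suc n) * (t - c))) has_real_derivative
        tent (real (Suc n) * (t - c)) * real (Suc n)) (at t)" for c
      by (rule DERIV_chain2[where f=ramp, OF ramp_deriv]) (auto intro!: derivative_eq_intros)
    from DERIV_diff[OF this[of s] this[of \<tau>]] show ?thesis
      by (simp add: \<phi>_def[abs_def] \<phi>'_def mult.commute)
  qed
  have cont_\<phi>[measurable]: "\<phi> n \<in> borel_measurable (interval_measure a b)" for n
  proof -
    have "continuous_on UNIV (\<phi> n)"
      using deriv DERIV_isCont continuous_at_imp_continuous_on by blast
    then have "\<phi> n \<in> borel_measurable borel" by (rule borel_measurable_continuous_onI)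
    then show ?thesis by (intro measurable_restrict_space1) simp
  qed
  have "\<forall>\<^sub>F n in sequentially. inverse (real (Suc n)) < b - \<tau>"
    using order_tendstoD(2)[OF LIMSEQ_inverse_real_of_nat, of "b - \<tau>"] st by simp
  then have eq: "\<forall>\<^sub>F n in sequentially.
      (\<integral>t. \<phi>' n t *\<^sub>R x t \<partial>interval_measure a b) = - (\<integral>t. \<phi> n t *\<^sub>R v t \<partial>interval_measure a b)"
  proof eventually_elim
    fix n assume n: "inverse (real (Suc n)) < b - \<tau>"
    have "test_function a b (\<phi> n) (\<phi>' n)"
      unfolding test_function_def
    proof (intro conjI allI exI[of _ "{s..\<tau> + inverse (real (Suc n))}"] impI)
      show "continuous_on UNIV (\<phi>' n)"
        unfolding \<phi>'_def by (intro continuous_on_diff cont_k)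
      fix t assume t: "t \<notin> {s..\<tau> + inverse (real (Suc n))}"
      show "\<phi> n t = 0"
      proof (cases "t < s")
        case True
        then show ?thesis using st by (simp add: \<phi>_def ramp_le mult_nonneg_nonpos)
      next
        case False
        then have "t > \<tau> + inverse (real (Suc n))" using t by auto
        then have "real (Suc n) * (t - \<tau>) \<ge> 1" "real (Suc n) * (t - s) \<ge> real (Suc n) * (t - \<tau>)"
          using st by (auto simp: field_simps simp del: of_nat_Suc)
        then have "real (Suc n) * (t - s) \<ge> 1" by (rule_tac order_trans)
        with \<open>real (Suc n) * (t - \<tau>) \<ge> 1\<close>
        have "ramp (real (Suc n) * (t - s)) = 1" "ramp (real (Suc n) * (t - \<tau>)) = 1"
          by (auto intro!: ramp_ge simp del: of_nat_Suc)
        then show ?thesis by (simp add: \<phi>_def del: of_nat_Suc)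
      qed
    qed (use deriv n st in auto)
    then show "(\<integral>t. \<phi>' n t *\<^sub>R x t \<partial>interval_measure a b) = - (\<integral>t. \<phi> n t *\<^sub>R v t \<partial>interval_measure a b)"
      using weak by (simp add: has_weak_derivative_def set_lebesgue_integral_interval)
  qed
  have 1: "(\<lambda>n. \<integral>t. \<phi>' n t *\<^sub>R x t \<partial>interval_measure a b) \<longlonglongrightarrow> x s - x \<tau>"
  proof -
    have "(\<integral>t. \<phi>' n t *\<^sub>R x t \<partial>interval_measure a b)
      = (\<integral>t. (real (Suc n) * tent (real (Suc n) * (t - s))) *\<^sub>R x t \<partial>interval_measure a b)
      - (\<integral>t. (real (Suc n) * tent (real (Suc n) * (t - \<tau>))) *\<^sub>R x t \<partial>interval_measure a b)" for n
      unfolding \<phi>'_def scaleR_left_diff_distrib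
      by (intro Bochner_Integration.integral_diff x_int cont_k)
    then show ?thesis
      using tendsto_diff[OF tent_kernel_tendsto[OF cont, of s] tent_kernel_tendsto[OF cont, of \<tau>]] st by simp
  qed
  have [measurable]: "(indicator {s<..\<tau>} :: real \<Rightarrow> real) \<in> borel_measurable (interval_measure a b)"
    by (intro measurable_restrict_space1) simp
  have 2: "(\<lambda>n. \<integral>t. \<phi> n t *\<^sub>R v t \<partial>interval_measure a b)
      \<longlonglongrightarrow> (\<integral>t. indicator {s<..\<tau>} t *\<^sub>R v t \<partial>interval_measure a b)"
  proof (rule integral_dominated_convergence[where w="\<lambda>t. 2 * norm (v t)"])
    show "integrable (interval_measure a b) (\<lambda>t. 2 * norm (v t))" using v by simp
    show "AE t in interval_measure a b. (\<lambda>n. \<phi> n t *\<^sub>R v t) \<longlonglongrightarrow> indicator {s<..\<tau>} t *\<^sub>R v t"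
    proof (intro AE_I2 tendsto_scaleR tendsto_const)
      fix t
      have r: "(\<lambda>n. ramp (real (Suc n) * (t - c))) \<longlonglongrightarrow> (if t > c then 1 else 0)" for c
      proof (cases "t > c")
        case True
        have "\<forall>\<^sub>F n in sequentially. inverse (real (Suc n)) < t - c"
          using order_tendstoD(2)[OF LIMSEQ_inverse_real_of_nat, of "t - c"] True by simp
        then have "\<forall>\<^sub>F n in sequentially. ramp (real (Suc n) * (t - c)) = 1"
          by eventually_elim (intro ramp_ge, simp add: field_simps del: of_nat_Suc)
        then show ?thesis using True by (simp add: tendsto_eventually)
      next
        case False
        then show ?thesis by (simp add: ramp_le mult_nonneg_nonpos del: of_nat_Suc)
      qed
      have "indicator {s<..\<tau>} t = (if t > s then 1 else 0) - (if t > \<tau> then 1 else (0::real))"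
        using st by (auto simp: indicator_def)
      then show "(\<lambda>n. \<phi> n t) \<longlonglongrightarrow> indicator {s<..\<tau>} t"
        unfolding \<phi>_def using tendsto_diff[OF r[of s] r[of \<tau>]] by simp
    qed
    show "AE t in interval_measure a b. norm (\<phi> n t *\<^sub>R v t) \<le> 2 * norm (v t)" for n
    proof (intro AE_I2)
      fix t
      have "\<bar>\<phi> n t\<bar> \<le> 2"
        unfolding \<phi>_def
        using ramp_bound[of "real (Suc n) * (t - s)"] ramp_bound[of "real (Suc n) * (t - \<tau>)"] by linarith
      then show "norm (\<phi> n t *\<^sub>R v t) \<le> 2 * norm (v t)" by (simp add: mult_right_mono)
    qed
  qed simp_all
  have "(\<lambda>n. \<integral>t. \<phi>' n t *\<^sub>R x t \<partial>interval_measure a b)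
      \<longlonglongrightarrow> - (\<integral>t. indicator {s<..\<tau>} t *\<^sub>R v t \<partial>interval_measure a b)"
    using tendsto_minus[OF 2] by (rule Lim_transform_eventually) (use eq in \<open>auto elim: eventually_mono\<close>)
  from LIMSEQ_unique[OF 1 this] show ?thesis by (simp add: algebra_simps minus_equation_iff)
qed

text \<open>
  The end points \<open>a\<close> and \<open>b\<close> cannot be reached by test functions; they are recovered because
  \<open>x - integral v\<close> is continuous on the closed interval and constant on the open one.
\<close>

theorem weak_derivative_FTC:
  fixes x :: "real \<Rightarrow> 'a::euclidean_space"
  assumes cont: "continuous_on {a..b} x" and v: "square_integrable a b v"
    and weak: "has_weak_derivative a b x v" and st: "a \<le> s" "s \<le> t" "t \<le> b"
  shows "x t - x s = integral {s..t} v"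
proof (cases "a < b")
  case False
  then have "s = t" using st by simp
  then show ?thesis by simp
next
  case ab: True
  interpret finite_measure "interval_measure a b" by (rule finite_measure_interval)
  have v1: "integrable (interval_measure a b) v"
    using v by (simp add: square_integrable_iff square_integrable_imp_integrable)
  have vint: "v integrable_on {a..b}"
    using square_integrable_absolutely_integrable[OF v] by (simp add: absolutely_integrable_on_def)
  define g where "g t = x t - integral {a..t} v" for t
  have cont_g: "continuous_on {a..b} g"
    unfolding g_def by (intro continuous_intros cont indefinite_integral_continuous_1 vint)
  have int_eq: "g \<sigma> = g \<tau>" if st: "a < \<sigma>" "\<sigma> \<le> \<tau>" "\<tau> < b" for \<sigma> \<tau>
  proof -
    have "x \<tau> - x \<sigma> = (\<integral>t. indicator {\<sigma><..\<tau>} t *\<^sub>R v t \<partial>interval_measure a b)"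
      by (rule weak_derivative_FTC_interior[OF cont v1 weak st])
    also have "\<dots> = (\<integral>t. indicator {a<..<b} t *\<^sub>R indicator {\<sigma><..\<tau>} t *\<^sub>R v t \<partial>lborel)"
      by (simp add: integral_restrict_space)
    also have "\<dots> = set_lebesgue_integral lborel {\<sigma><..\<tau>} v"
      unfolding set_lebesgue_integral_def
      using st by (intro Bochner_Integration.integral_cong) (auto simp: indicator_def)
    also have "\<dots> = integral {\<sigma><..\<tau>} v"
    proof (rule set_borel_integral_eq_integral)
      show "set_integrable lborel {\<sigma><..\<tau>} v"
        by (rule set_integrable_subset[of lborel "{a<..<b}"]) (use v1 st in \<open>auto simp: set_integrable_interval\<close>)
    qed
    also have "\<dots> = integral {\<sigma>..\<tau>} v"
    proof (rule integral_spike_set)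
      show "negligible {t \<in> {\<sigma><..\<tau>} - {\<sigma>..\<tau>}. v t \<noteq> 0}" by (rule negligible_subset[of "{}"]) auto
      show "negligible {t \<in> {\<sigma>..\<tau>} - {\<sigma><..\<tau>}. v t \<noteq> 0}" by (rule negligible_subset[of "{\<sigma>}"]) auto
    qed
    also have "\<dots> = integral {a..\<tau>} v - integral {a..\<sigma>} v"
      using Henstock_Kurzweil_Integration.integral_combine[of a \<sigma> \<tau> v] st
        integrable_on_subinterval[OF vint, of a \<tau>] by (auto simp: algebra_simps)
    finally show ?thesis by (simp add: g_def algebra_simps)
  qed
  define m where "m = (a + b) / 2"
  have m: "a < m" "m < b" using ab by (auto simp: m_def)
  have inner: "g \<tau> = g m" if "\<tau> \<in> {a<..<b}" for \<tau>
  proof (cases "\<tau> \<le> m")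
    case True
    then show ?thesis using that m by (intro int_eq) auto
  next
    case False
    then show ?thesis using that m by (intro int_eq[symmetric]) auto
  qed
  have const: "g \<tau> = g m" if "\<tau> \<in> {a..b}" for \<tau>
  proof (rule continuous_constant_on_closure[of "{a<..<b}" g])
    show "continuous_on (closure {a<..<b}) g" "\<tau> \<in> closure {a<..<b}"
      using cont_g that ab by simp_all
    show "g u = g m" if "u \<in> {a<..<b}" for u using that by (rule inner)
  qed
  have "g s = g t" using const[of s] const[of t] st by simp
  moreover have "integral {a..t} v = integral {a..s} v + integral {s..t} v"
    using Henstock_Kurzweil_Integration.integral_combine[of a s t v] st
      integrable_on_subinterval[OF vint, of a t] by auto
  ultimately show ?thesis by (simp add: g_def algebra_simps)
qed

text \<open>
  The difference of two weak derivatives has integral zero over every half line, hence over every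
  Borel set by a Dynkin argument, and therefore vanishes almost everywhere.
\<close>

theorem weak_derivative_unique:
  fixes x :: "real \<Rightarrow> 'a::euclidean_space"
  assumes cont: "continuous_on {a..b} x"
    and v: "square_integrable a b v" "has_weak_derivative a b x v"
    and w: "square_integrable a b w" "has_weak_derivative a b x w"
  shows "AE t in interval_measure a b. v t = w t"
proof -
  interpret finite_measure "interval_measure a b" by (rule finite_measure_interval)
  define f where "f t = v t - w t" for t
  have sq: "square_integrable a b f"
    using v(1) w(1) square_integrable_on_diff unfolding f_def square_integrable_iff by blast
  \<comment> \<open>extension by zero, so that half lines can serve as the generator of the Borel sets\<close>
  define g where "g t = indicator {a<..<b} t *\<^sub>R f t" for t
  have g_int: "integrable lborel g"
    using sq square_integrable_imp_integrable set_integrable_interval[of a b f]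
    unfolding g_def set_integrable_def square_integrable_iff by blast
  have zero: "set_lebesgue_integral lborel {..t} g = 0" for t
  proof (cases "a \<le> t \<and> a \<le> b")
    case True
    define \<tau> where "\<tau> = min t b"
    have \<tau>: "a \<le> \<tau>" "\<tau> \<le> b" using True by (auto simp: \<tau>_def)
    have ae: "AE u in lborel. indicator {..t} u *\<^sub>R g u = indicator {a<..<\<tau>} u *\<^sub>R f u"
      using AE_lborel_singleton[of \<tau>] AE_lborel_singleton[of t]
      by eventually_elim (auto simp: g_def \<tau>_def indicator_def min_def split: if_splits)
    have sub: "square_integrable a \<tau> v" "square_integrable a \<tau> w" "square_integrable a \<tau> f"
      using square_integrable_subinterval v(1) w(1) sq \<tau> by blast+
    interpret sub: finite_measure "interval_measure a \<tau>" by (rule finite_measure_interval)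
    have "set_lebesgue_integral lborel {..t} g = set_lebesgue_integral lborel {a<..<\<tau>} f"
      unfolding set_lebesgue_integral_def
      using g_int sub(3) sub.square_integrable_imp_integrable
      by (intro integral_cong_AE[OF _ _ ae] borel_measurable_integrable)
        (auto simp: square_integrable_iff set_integrable_interval[symmetric] set_integrable_def integrable_mult_indicator)
    also have "\<dots> = integral {a..\<tau>} v - integral {a..\<tau>} w"
    proof -
      have "integrable (interval_measure a \<tau>) v" "integrable (interval_measure a \<tau>) w"
        using sub by (auto simp: square_integrable_iff intro: sub.square_integrable_imp_integrable)
      then show ?thesis
        by (simp add: set_lebesgue_integral_interval f_def[abs_def] integral_interval_eq[symmetric])
    qed
    also have "\<dots> = 0"
      using weak_derivative_FTC[OF cont v, of a \<tau>] weak_derivative_FTC[OF cont w, of a \<tau>] \<tau> by simp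
    finally show ?thesis .
  next
    case False
    then have "(\<lambda>u. indicator {..t} u *\<^sub>R g u) = (\<lambda>u. 0)" by (auto simp: g_def indicator_def)
    then show ?thesis by (simp only: set_lebesgue_integral_def Bochner_Integration.integral_zero)
  qed
  have whole: "set_lebesgue_integral lborel UNIV g = 0"
  proof -
    have "indicator UNIV u *\<^sub>R g u = indicator {..b} u *\<^sub>R g u" for u
      by (auto simp: g_def indicator_def)
    then show ?thesis using zero[of b] by (simp only: set_lebesgue_integral_def)
  qed
  have g_set: "set_integrable lborel A g" if "A \<in> sets borel" for A
    unfolding set_integrable_def using g_int that by (intro integrable_mult_indicator) auto
  have "set_lebesgue_integral lborel A g = 0" if "A \<in> sets borel" for A
  proof -
    have "Int_stable (range (atMost :: real \<Rightarrow> real set))"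
      by (auto simp: Int_stable_def)
    moreover have "range atMost \<subseteq> Pow (UNIV :: real set)" by simp
    moreover have "A \<in> sigma_sets UNIV (range atMost)"
      using that by (simp add: borel_eq_atMost)
    ultimately show ?thesis
    proof (induction rule: sigma_sets_induct_disjoint)
      case (basic A)
      then show ?case using zero by auto
    next
      case (compl A)
      then have A: "A \<in> sets borel" by (simp add: borel_eq_atMost)
      have "set_lebesgue_integral lborel (A \<union> (UNIV - A)) g
          = set_lebesgue_integral lborel A g + set_lebesgue_integral lborel (UNIV - A) g"
        using A by (intro set_integral_Un g_set) auto
      then show ?case using whole compl by simp
    next
      case (union A)
      then have A: "A i \<in> sets borel" for i by (auto simp: borel_eq_atMost)
      have "set_lebesgue_integral lborel (\<Union>i. A i) g = (\<Sum>i. set_lebesgue_integral lborel (A i) g)"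
        by (rule lebesgue_integral_countable_add)
          (use A union(1) g_set in \<open>auto simp: disjoint_family_on_def\<close>)
      then show ?case using union by simp
    qed (simp add: set_lebesgue_integral_def)
  qed
  then have "AE t in lborel. g t = 0"
    using sigma_finite_measure.density_zero[OF sigma_finite_lborel g_int] by simp
  then have "AE t in lborel. t \<in> {a<..<b} \<longrightarrow> v t = w t"
    by eventually_elim (auto simp: g_def f_def)
  then show ?thesis by (simp add: AE_restrict_space_iff)
qed

section \<open>Paths with a square integrable weak derivative\<close>

abbreviation energy :: "real \<Rightarrow> real \<Rightarrow> (real \<Rightarrow> 'a::euclidean_space) \<Rightarrow> real" where
  "energy a b v \<equiv> \<integral>t. (norm (v t))\<^sup>2 \<partial>interval_measure a b"

text \<open>
  A path together with one of its weak derivatives. Limits and reparametrisations come with an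
  explicit derivative, so statements about pairs avoid the arbitrary choice made in
  \<^const>\<open>weak_derivative\<close>.
\<close>

definition sobolev_pair :: "real \<Rightarrow> real \<Rightarrow> (real \<Rightarrow> 'a::euclidean_space) \<Rightarrow> (real \<Rightarrow> 'a) \<Rightarrow> bool" where
  "sobolev_pair a b x v \<longleftrightarrow>
     continuous_on {a..b} x \<and> square_integrable a b v \<and> has_weak_derivative a b x v"

lemma continuous_square_integrable:
  assumes "continuous_on {a..b} x"
  shows "square_integrable a b x"
proof -
  have "set_integrable lborel {a..b} (\<lambda>t. (norm (x t))\<^sup>2)" "set_integrable lborel {a..b} x"
    by (intro borel_integrable_atLeastAtMost' continuous_intros assms)+
  then have "set_integrable lborel {a<..<b} (\<lambda>t. (norm (x t))\<^sup>2)" "set_integrable lborel {a<..<b} x"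
    by (auto intro: set_integrable_subset)
  then show ?thesis
    unfolding square_integrable_def set_integrable_def set_borel_measurable_def by auto
qed

lemma H1_iff: "x \<in> H1 a b \<longleftrightarrow> (\<exists>v. sobolev_pair a b x v)"
  unfolding H1_def sobolev_pair_def using continuous_square_integrable by auto

lemma sobolev_pair_weak_derivative:
  assumes "x \<in> H1 a b"
  shows "sobolev_pair a b x (weak_derivative a b x)"
proof -
  have "\<exists>v. square_integrable a b v \<and> has_weak_derivative a b x v"
    using assms by (auto simp: H1_def)
  then have "square_integrable a b (weak_derivative a b x) \<and> has_weak_derivative a b x (weak_derivative a b x)"
    unfolding weak_derivative_def by (rule someI_ex)
  then show ?thesis using assms by (simp add: sobolev_pair_def H1_def)
qed

lemma sobolev_pair_AE_eq:
  assumes "sobolev_pair a b x v"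
  shows "AE t in interval_measure a b. weak_derivative a b x t = v t"
  using weak_derivative_unique[of a b x "weak_derivative a b x" v] assms
    sobolev_pair_weak_derivative[of x a b] H1_iff[of x a b]
  by (auto simp: sobolev_pair_def)

lemma sobolev_pair_energy:
  assumes "sobolev_pair a b x v"
  shows "energy a b (weak_derivative a b x) = energy a b v"
proof (rule integral_cong_AE)
  have "sobolev_pair a b x (weak_derivative a b x)"
    using assms sobolev_pair_weak_derivative H1_iff by blast
  then show "(\<lambda>t. (norm (weak_derivative a b x t))\<^sup>2) \<in> borel_measurable (interval_measure a b)"
    "(\<lambda>t. (norm (v t))\<^sup>2) \<in> borel_measurable (interval_measure a b)"
    using assms by (auto simp: sobolev_pair_def square_integrable_iff square_integrable_on_def)
  show "AE t in interval_measure a b. (norm (weak_derivative a b x t))\<^sup>2 = (norm (v t))\<^sup>2"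
    using sobolev_pair_AE_eq[OF assms] by eventually_elim simp
qed

text \<open>
  Half Hoelder continuity, the source of equicontinuity for paths of bounded energy; applied to the
  end points it also bounds the energy from below.
\<close>

lemma sobolev_pair_Hoelder:
  assumes "sobolev_pair a b x v" and st: "a \<le> s" "s \<le> t" "t \<le> b"
  shows "(norm (x t - x s))\<^sup>2 \<le> (t - s) * energy a b v"
proof -
  interpret finite_measure "interval_measure s t" by (rule finite_measure_interval)
  have v: "square_integrable a b v" using assms by (simp add: sobolev_pair_def)
  have vs: "square_integrable s t v" by (rule square_integrable_subinterval[OF v]) (use st in auto)
  have "x t - x s = integral {s..t} v"
    using assms by (intro weak_derivative_FTC) (auto simp: sobolev_pair_def)
  also have "\<dots> = integral\<^sup>L (interval_measure s t) v"
    using vs by (intro integral_interval_eq[symmetric] square_integrable_imp_integrable)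
      (simp add: square_integrable_iff)
  finally have "norm (x t - x s) \<le> (\<integral>u. norm (v u) \<partial>interval_measure s t)"
    by (simp add: integral_norm_bound)
  then have "(norm (x t - x s))\<^sup>2 \<le> (\<integral>u. norm (v u) \<partial>interval_measure s t)\<^sup>2"
    by (intro power_mono) auto
  also have "\<dots> \<le> (t - s) * energy s t v"
    using integral_norm_sq_le[of v] vs st measure_interval[of s t] by (simp add: square_integrable_iff)
  also have "energy s t v \<le> energy a b v"
  proof -
    have "set_lebesgue_integral lborel {s<..<t} (\<lambda>t. (norm (v t))\<^sup>2)
        \<le> set_lebesgue_integral lborel {a<..<b} (\<lambda>t. (norm (v t))\<^sup>2)"
      unfolding set_lebesgue_integral_def
      using v vs st by (intro integral_mono)
        (auto simp: square_integrable_def set_integrable_def indicator_def)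
    then show ?thesis by (simp add: set_lebesgue_integral_interval)
  qed
  finally show ?thesis using st by (simp add: mult_left_mono)
qed

lemma test_function_continuous:
  assumes "test_function a b \<phi> \<phi>'"
  shows "continuous_on A \<phi>" "continuous_on A \<phi>'"
proof -
  have "isCont \<phi> t" for t
    using assms DERIV_isCont[of \<phi> "\<phi>' t" t] by (simp add: test_function_def)
  then have "continuous_on UNIV \<phi>" by (simp add: continuous_at_imp_continuous_on)
  then show "continuous_on A \<phi>" "continuous_on A \<phi>'"
    using assms by (auto simp: test_function_def intro: continuous_on_subset)
qed

lemma test_function_outside:
  assumes "test_function a b \<phi> \<phi>'" "t \<notin> {a<..<b}"
  shows "\<phi> t = 0"
  using assms by (auto simp: test_function_def)

lemma continuous_bounded:
  fixes f :: "real \<Rightarrow> 'a::real_normed_vector"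
  assumes "continuous_on {a..b} f"
  obtains B where "B \<ge> 0" "\<And>t. t \<in> {a..b} \<Longrightarrow> norm (f t) \<le> B"
proof -
  have "bounded (f ` {a..b})"
    using assms by (intro compact_imp_bounded compact_continuous_image) auto
  then obtain B where B: "\<And>t. t \<in> {a..b} \<Longrightarrow> norm (f t) \<le> B"
    unfolding bounded_iff by blast
  show ?thesis
  proof
    show "norm (f t) \<le> \<bar>B\<bar>" if "t \<in> {a..b}" for t using B[OF that] by linarith
  qed simp
qed

lemma integrable_scaleR_continuous:
  fixes f :: "real \<Rightarrow> 'a::euclidean_space"
  assumes h: "continuous_on {a..b} h" and f: "integrable (interval_measure a b) f"
  shows "integrable (interval_measure a b) (\<lambda>t. h t *\<^sub>R f t)"
proof -
  obtain B where B: "B \<ge> 0" "\<And>t. t \<in> {a..b} \<Longrightarrow> norm (h t) \<le> B"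
    by (rule continuous_bounded[OF h]) blast
  have "h \<in> borel_measurable (interval_measure a b)"
    using continuous_square_integrable[OF h] by (simp add: square_integrable_iff square_integrable_on_def)
  moreover have "f \<in> borel_measurable (interval_measure a b)" using f by simp
  ultimately have m: "(\<lambda>t. h t *\<^sub>R f t) \<in> borel_measurable (interval_measure a b)" by simp
  show ?thesis
  proof (rule Bochner_Integration.integrable_bound[OF _ m])
    show "integrable (interval_measure a b) (\<lambda>t. \<bar>B\<bar> *\<^sub>R f t)" using f by simp
    show "AE t in interval_measure a b. norm (h t *\<^sub>R f t) \<le> norm (\<bar>B\<bar> *\<^sub>R f t)"
    proof (intro AE_I2)
      fix t assume "t \<in> space (interval_measure a b)"
      then have "t \<in> {a..b}" by (simp add: space_restrict_space)
      then have "\<bar>h t\<bar> \<le> \<bar>B\<bar>" using B(2)[of t] B(1) by simp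
      then show "norm (h t *\<^sub>R f t) \<le> norm (\<bar>B\<bar> *\<^sub>R f t)" by (simp add: mult_right_mono)
    qed
  qed
qed

text \<open>
  Finitely many exceptional times are allowed because a path through the origin need not be
  differentiable there. The product of the path with a test function is continuous, so the fundamental
  theorem of calculus holds across these times.
\<close>

lemma sobolev_pair_if_differentiable:
  fixes x :: "real \<Rightarrow> 'a::euclidean_space"
  assumes x: "continuous_on {a..b} x" and ab: "a \<le> b" and S: "finite S"
    and deriv: "\<And>t. t \<in> {a<..<b} - S \<Longrightarrow> (x has_vector_derivative v t) (at t)"
    and v: "square_integrable a b v"
  shows "sobolev_pair a b x v"
  unfolding sobolev_pair_def has_weak_derivative_def set_lebesgue_integral_interval
proof (intro conjI allI impI x v)
  interpret finite_measure "interval_measure a b" by (rule finite_measure_interval)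
  let ?M = "interval_measure a b"
  fix \<phi> \<phi>' assume test: "test_function a b \<phi> \<phi>'"
  have cs: "continuous_on {a..b} \<phi>" "continuous_on {a..b} \<phi>'"
    by (rule test_function_continuous[OF test])+
  have i: "integrable ?M (\<lambda>t. \<phi> t *\<^sub>R v t)" "integrable ?M (\<lambda>t. \<phi>' t *\<^sub>R x t)"
    using v continuous_square_integrable[OF x]
    by (auto intro!: integrable_scaleR_continuous[OF cs(1)] integrable_scaleR_continuous[OF cs(2)] intro: square_integrable_imp_integrable simp: square_integrable_iff)
  have "((\<lambda>t. \<phi> t *\<^sub>R v t + \<phi>' t *\<^sub>R x t) has_integral (\<phi> b *\<^sub>R x b - \<phi> a *\<^sub>R x a)) {a..b}"
  proof (rule fundamental_theorem_of_calculus_interior_strong[OF S ab])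
    show "continuous_on {a..b} (\<lambda>t. \<phi> t *\<^sub>R x t)" by (intro continuous_intros cs x)
    fix t assume t: "t \<in> {a<..<b} - S"
    have "(\<phi> has_real_derivative \<phi>' t) (at t)" using test by (simp add: test_function_def)
    from has_vector_derivative_scaleR[OF this deriv[OF t]]
    show "((\<lambda>t. \<phi> t *\<^sub>R x t) has_vector_derivative (\<phi> t *\<^sub>R v t + \<phi>' t *\<^sub>R x t)) (at t)" .
  qed
  then have "integral {a..b} (\<lambda>t. \<phi> t *\<^sub>R v t + \<phi>' t *\<^sub>R x t) = 0"
    using test_function_outside[OF test, of a] test_function_outside[OF test, of b]
    by (auto dest: integral_unique)
  then have "(\<integral>t. \<phi> t *\<^sub>R v t \<partial>?M) + (\<integral>t. \<phi>' t *\<^sub>R x t \<partial>?M) = 0"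
    using i integral_interval_eq[of a b "\<lambda>t. \<phi> t *\<^sub>R v t + \<phi>' t *\<^sub>R x t"] by simp
  then show "(\<integral>t. \<phi>' t *\<^sub>R x t \<partial>?M) = - (\<integral>t. \<phi> t *\<^sub>R v t \<partial>?M)"
    by (simp add: eq_neg_iff_add_eq_0 add.commute)
qed

lemma integral_interval_affine:
  fixes f :: "real \<Rightarrow> 'a::euclidean_space"
  assumes p: "p > 0"
  shows "(\<integral>t. f t \<partial>interval_measure (p * c + q) (p * d + q)) = p *\<^sub>R (\<integral>s. f (p * s + q) \<partial>interval_measure c d)"
proof -
  have ind: "indicator {p * c + q<..<p * d + q} (p * s + q) = (indicator {c<..<d} s :: real)" for s
    using p by (auto simp: indicator_def add.commute)
  have "(\<integral>t. f t \<partial>interval_measure (p * c + q) (p * d + q))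
      = (\<integral>t. indicator {p * c + q<..<p * d + q} t *\<^sub>R f t \<partial>lborel)"
    by (simp add: integral_restrict_space)
  also have "\<dots> = p *\<^sub>R (\<integral>s. indicator {c<..<d} s *\<^sub>R f (p * s + q) \<partial>lborel)"
    using p by (subst lborel_integral_real_affine[where c=p and t=q]) (simp_all add: ind add.commute[of q])
  finally show ?thesis by (simp add: integral_restrict_space)
qed

lemma integrable_interval_affine:
  fixes f :: "real \<Rightarrow> 'a::euclidean_space"
  assumes p: "p > 0" and f: "integrable (interval_measure (p * c + q) (p * d + q)) f"
  shows "integrable (interval_measure c d) (\<lambda>s. f (p * s + q))"
proof -
  have ind: "indicator {p * c + q<..<p * d + q} (p * s + q) = (indicator {c<..<d} s :: real)" for s
    using p by (auto simp: indicator_def add.commute)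
  have "integrable lborel (\<lambda>t. indicator {p * c + q<..<p * d + q} t *\<^sub>R f t)"
    using f by (simp add: integrable_restrict_space)
  from lborel_integrable_real_affine[OF this, of p q] p show ?thesis
    by (simp add: integrable_restrict_space ind add.commute[of q])
qed

text \<open>
  An affine change of time with speed \<open>p\<close> multiplies the kinetic energy by \<open>p\<close>, whereas it divides
  integrals of functions of the position by \<open>p\<close>.
\<close>

theorem sobolev_pair_affine:
  fixes x :: "real \<Rightarrow> 'a::euclidean_space"
  assumes p: "p > 0" and xv: "sobolev_pair (p * c + q) (p * d + q) x v"
  shows "sobolev_pair c d (\<lambda>s. x (p * s + q)) (\<lambda>s. p *\<^sub>R v (p * s + q))"
    "energy c d (\<lambda>s. p *\<^sub>R v (p * s + q)) = p * energy (p * c + q) (p * d + q) v"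
proof -
  interpret finite_measure "interval_measure c d" by (rule finite_measure_interval)
  interpret M: finite_measure "interval_measure (p * c + q) (p * d + q)" by (rule finite_measure_interval)
  have "square_integrable_on (interval_measure (p * c + q) (p * d + q)) v"
    using xv by (simp add: sobolev_pair_def square_integrable_iff)
  then have "integrable (interval_measure (p * c + q) (p * d + q)) v"
    "integrable (interval_measure (p * c + q) (p * d + q)) (\<lambda>t. (norm (v t))\<^sup>2)"
    by (auto intro: M.square_integrable_imp_integrable simp: square_integrable_on_def)
  from integrable_interval_affine[OF p this(1)] integrable_interval_affine[OF p this(2)]
  have "square_integrable_on (interval_measure c d) (\<lambda>s. v (p * s + q))"
    by (simp add: square_integrable_on_def)
  from square_integrable_on_scaleR[OF this, of p]
  have sq: "square_integrable c d (\<lambda>s. p *\<^sub>R v (p * s + q))" by (simp add: square_integrable_iff)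
  show "energy c d (\<lambda>s. p *\<^sub>R v (p * s + q)) = p * energy (p * c + q) (p * d + q) v"
  proof -
    have "energy c d (\<lambda>s. p *\<^sub>R v (p * s + q)) = p\<^sup>2 * energy c d (\<lambda>s. v (p * s + q))"
      by (simp add: power_mult_distrib)
    then show ?thesis by (simp add: integral_interval_affine[OF p] power2_eq_square)
  qed
  have cont: "continuous_on {c..d} (\<lambda>s. x (p * s + q))"
  proof (rule continuous_on_compose2[where g=x])
    show "continuous_on {p * c + q..p * d + q} x" using xv by (simp add: sobolev_pair_def)
  qed (use p in \<open>auto intro!: continuous_intros\<close>)
  show "sobolev_pair c d (\<lambda>s. x (p * s + q)) (\<lambda>s. p *\<^sub>R v (p * s + q))"
    unfolding sobolev_pair_def has_weak_derivative_def set_lebesgue_integral_interval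
  proof (intro conjI allI impI cont sq)
    fix \<phi> \<phi>' assume test: "test_function c d \<phi> \<phi>'"
    define \<psi> where "\<psi> t = \<phi> ((t - q) / p)" for t
    define \<psi>' where "\<psi>' t = \<phi>' ((t - q) / p) / p" for t
    have "test_function (p * c + q) (p * d + q) \<psi> \<psi>'"
      unfolding test_function_def
    proof (intro conjI allI)
      show "(\<psi> has_real_derivative \<psi>' t) (at t)" for t
      proof -
        have "(\<phi> has_real_derivative \<phi>' ((t - q) / p)) (at ((t - q) / p))"
          using test by (simp add: test_function_def)
        moreover have "((\<lambda>t. (t - q) / p) has_real_derivative 1 / p) (at t)"
          using p by (auto intro!: derivative_eq_intros)
        ultimately show ?thesis
          unfolding \<psi>_def[abs_def] \<psi>'_def using DERIV_chain2[where f=\<phi> and g="\<lambda>t. (t - q) / p"] by fastforce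
      qed
      show "continuous_on UNIV \<psi>'"
        unfolding \<psi>'_def[abs_def] using p
        by (auto intro!: continuous_intros continuous_on_compose2[OF test_function_continuous(2)[OF test, of UNIV]])
      obtain K where K: "compact K" "K \<subseteq> {c<..<d}" "\<And>t. t \<notin> K \<Longrightarrow> \<phi> t = 0"
        using test by (auto simp: test_function_def)
      have "compact ((\<lambda>s. p * s + q) ` K)"
        by (intro compact_continuous_image K continuous_intros)
      moreover have "(\<lambda>s. p * s + q) ` K \<subseteq> {p * c + q<..<p * d + q}" using K(2) p by auto
      moreover have "\<psi> t = 0" if "t \<notin> (\<lambda>s. p * s + q) ` K" for t
      proof -
        have "(t - q) / p \<notin> K"
        proof
          assume "(t - q) / p \<in> K"
          then have "p * ((t - q) / p) + q \<in> (\<lambda>s. p * s + q) ` K" by (rule imageI)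
          then show False using that p by simp
        qed
        then show ?thesis by (simp add: \<psi>_def K(3))
      qed
      ultimately show "\<exists>K. compact K \<and> K \<subseteq> {p * c + q<..<p * d + q} \<and> (\<forall>t. t \<notin> K \<longrightarrow> \<psi> t = 0)" by blast
    qed
    then have "(\<integral>t. \<psi>' t *\<^sub>R x t \<partial>interval_measure (p * c + q) (p * d + q))
        = - (\<integral>t. \<psi> t *\<^sub>R v t \<partial>interval_measure (p * c + q) (p * d + q))"
      using xv by (simp add: sobolev_pair_def has_weak_derivative_def set_lebesgue_integral_interval)
    moreover have "\<psi> (p * s + q) = \<phi> s" "p *\<^sub>R \<psi>' (p * s + q) = \<phi>' s" for s using p by (auto simp: \<psi>_def \<psi>'_def)
    moreover from this have "p *\<^sub>R (\<psi>' (p * s + q) *\<^sub>R y) = \<phi>' s *\<^sub>R y" for s and y :: 'a by (metis scaleR_scaleR real_scaleR_def)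
    ultimately show "(\<integral>s. \<phi>' s *\<^sub>R x (p * s + q) \<partial>interval_measure c d)
        = - (\<integral>s. \<phi> s *\<^sub>R p *\<^sub>R v (p * s + q) \<partial>interval_measure c d)"
      unfolding integral_interval_affine[OF p] Bochner_Integration.integral_scaleR_right[symmetric]
      by (simp add: mult.commute)
  qed
qed

section \<open>Lower semicontinuity of the kinetic energy\<close>

text \<open>
  Uniform convergence of the paths and mean square convergence of the derivatives suffice to pass to
  the limit on the two sides of the integration by parts formula.
\<close>

lemma sobolev_pair_limit:
  fixes x :: "real \<Rightarrow> 'a::euclidean_space"
  assumes pair: "\<And>n. sobolev_pair a b (y n) (w n)" and x: "continuous_on {a..b} x"
    and conv: "\<And>n t. t \<in> {a..b} \<Longrightarrow> norm (y n t - x t) \<le> e n" "e \<longlonglongrightarrow> 0"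
    and w: "square_integrable a b v" "(\<lambda>n. energy a b (\<lambda>t. w n t - v t)) \<longlonglongrightarrow> 0"
  shows "sobolev_pair a b x v"
  unfolding sobolev_pair_def has_weak_derivative_def set_lebesgue_integral_interval
proof (intro conjI allI impI x w(1))
  interpret finite_measure "interval_measure a b" by (rule finite_measure_interval)
  fix \<phi> \<phi>' assume test: "test_function a b \<phi> \<phi>'"
  let ?M = "interval_measure a b"
  have cs: "continuous_on {a..b} \<phi>" "continuous_on {a..b} \<phi>'"
    by (rule test_function_continuous[OF test])+
  obtain B where B0: "B \<ge> 0" and B: "\<And>t. t \<in> {a..b} \<Longrightarrow> norm (\<phi> t) \<le> B"
    by (rule continuous_bounded[OF cs(1)]) blast
  obtain B' where B0': "B' \<ge> 0" and B': "\<And>t. t \<in> {a..b} \<Longrightarrow> norm (\<phi>' t) \<le> B'"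
    by (rule continuous_bounded[OF cs(2)]) blast
  have int_cont: "integrable ?M f" if "continuous_on {a..b} f" for f :: "real \<Rightarrow> 'a"
    using continuous_square_integrable[OF that]
    by (simp add: square_integrable_iff square_integrable_imp_integrable)
  have wn: "square_integrable_on ?M (w n)" for n using pair by (simp add: sobolev_pair_def square_integrable_iff)
  have yn: "continuous_on {a..b} (y n)" for n using pair by (simp add: sobolev_pair_def)
  have v: "square_integrable_on ?M v" using w by (simp add: square_integrable_iff)
  have 1: "(\<lambda>n. \<integral>t. \<phi>' t *\<^sub>R y n t \<partial>?M) \<longlonglongrightarrow> (\<integral>t. \<phi>' t *\<^sub>R x t \<partial>?M)"
  proof (rule LIM_zero_cancel, rule Lim_null_comparison)
    show "(\<lambda>n. B' * e n * measure ?M (space ?M)) \<longlonglongrightarrow> 0"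
      using conv(2) by (auto intro!: tendsto_eq_intros)
    have "norm ((\<integral>t. \<phi>' t *\<^sub>R y n t \<partial>?M) - (\<integral>t. \<phi>' t *\<^sub>R x t \<partial>?M)) \<le> B' * e n * measure ?M (space ?M)" for n
    proof -
      have "(\<integral>t. \<phi>' t *\<^sub>R y n t \<partial>?M) - (\<integral>t. \<phi>' t *\<^sub>R x t \<partial>?M) = (\<integral>t. \<phi>' t *\<^sub>R (y n t - x t) \<partial>?M)"
        unfolding scaleR_right_diff_distrib
        by (rule Bochner_Integration.integral_diff[symmetric]) (intro int_cont continuous_intros cs yn x)+
      also have "norm \<dots> \<le> (\<integral>t. norm (\<phi>' t *\<^sub>R (y n t - x t)) \<partial>?M)" by (rule integral_norm_bound)
      also have "\<dots> \<le> (\<integral>t. B' * e n \<partial>?M)"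
      proof (rule integral_mono)
        show "integrable ?M (\<lambda>t. norm (\<phi>' t *\<^sub>R (y n t - x t)))"
          by (intro integrable_norm int_cont continuous_intros cs yn x)
        fix t assume "t \<in> space ?M"
        then have "t \<in> {a..b}" by (simp add: space_restrict_space)
        then show "norm (\<phi>' t *\<^sub>R (y n t - x t)) \<le> B' * e n"
          using B'[of t] conv(1)[of t n] B0' by (auto intro!: mult_mono)
      qed simp
      finally show ?thesis by (simp add: mult_ac)
    qed
    then show "\<forall>\<^sub>F n in sequentially. norm ((\<integral>t. \<phi>' t *\<^sub>R y n t \<partial>?M) - (\<integral>t. \<phi>' t *\<^sub>R x t \<partial>?M))
      \<le> B' * e n * measure ?M (space ?M)" by simp
  qed
  have 2: "(\<lambda>n. \<integral>t. \<phi> t *\<^sub>R w n t \<partial>?M) \<longlonglongrightarrow> (\<integral>t. \<phi> t *\<^sub>R v t \<partial>?M)"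
  proof (rule LIM_zero_cancel, rule Lim_null_comparison)
    show "(\<lambda>n. B * sqrt (measure ?M (space ?M) * energy a b (\<lambda>t. w n t - v t))) \<longlonglongrightarrow> 0"
      using w(2) by (auto intro!: tendsto_eq_intros)
    have "norm ((\<integral>t. \<phi> t *\<^sub>R w n t \<partial>?M) - (\<integral>t. \<phi> t *\<^sub>R v t \<partial>?M))
       \<le> B * sqrt (measure ?M (space ?M) * energy a b (\<lambda>t. w n t - v t))" for n
    proof -
      have sq: "square_integrable_on ?M (\<lambda>t. w n t - v t)" by (rule square_integrable_on_diff[OF wn v])
      have "(\<integral>t. \<phi> t *\<^sub>R w n t \<partial>?M) - (\<integral>t. \<phi> t *\<^sub>R v t \<partial>?M) = (\<integral>t. \<phi> t *\<^sub>R (w n t - v t) \<partial>?M)"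
        unfolding scaleR_right_diff_distrib
        by (rule Bochner_Integration.integral_diff[symmetric])
          (intro integrable_scaleR_continuous cs square_integrable_imp_integrable wn v)+
      also have "norm \<dots> \<le> (\<integral>t. norm (\<phi> t *\<^sub>R (w n t - v t)) \<partial>?M)" by (rule integral_norm_bound)
      also have "\<dots> \<le> (\<integral>t. B * norm (w n t - v t) \<partial>?M)"
      proof (rule integral_mono)
        show "integrable ?M (\<lambda>t. norm (\<phi> t *\<^sub>R (w n t - v t)))"
          by (intro integrable_norm integrable_scaleR_continuous cs square_integrable_imp_integrable sq)
        show "integrable ?M (\<lambda>t. B * norm (w n t - v t))"
          by (intro integrable_mult_right integrable_norm square_integrable_imp_integrable sq)
      qed (use B in \<open>auto intro!: mult_right_mono simp: space_restrict_space\<close>)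
      also have "\<dots> = B * (\<integral>t. norm (w n t - v t) \<partial>?M)" by simp
      also have "(\<integral>t. norm (w n t - v t) \<partial>?M) \<le> sqrt (measure ?M (space ?M) * energy a b (\<lambda>t. w n t - v t))"
        by (rule real_le_rsqrt) (rule integral_norm_sq_le[OF sq])
      finally show ?thesis using B0 by (simp add: mult_left_mono)
    qed
    then show "\<forall>\<^sub>F n in sequentially. norm ((\<integral>t. \<phi> t *\<^sub>R w n t \<partial>?M) - (\<integral>t. \<phi> t *\<^sub>R v t \<partial>?M))
       \<le> B * sqrt (measure ?M (space ?M) * energy a b (\<lambda>t. w n t - v t))" by simp
  qed
  have "(\<integral>t. \<phi>' t *\<^sub>R y n t \<partial>?M) = - (\<integral>t. \<phi> t *\<^sub>R w n t \<partial>?M)" for n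
    using pair test by (simp add: sobolev_pair_def has_weak_derivative_def set_lebesgue_integral_interval)
  then have "(\<lambda>n. \<integral>t. \<phi>' t *\<^sub>R y n t \<partial>?M) \<longlonglongrightarrow> - (\<integral>t. \<phi> t *\<^sub>R v t \<partial>?M)"
    using tendsto_minus[OF 2] by simp
  from LIMSEQ_unique[OF 1 this]
  show "(\<integral>t. \<phi>' t *\<^sub>R x t \<partial>?M) = - (\<integral>t. \<phi> t *\<^sub>R v t \<partial>?M)" .
qed

lemma sobolev_pair_midpoint:
  assumes "sobolev_pair a b x v" "sobolev_pair a b y w"
  shows "sobolev_pair a b (\<lambda>t. (1/2) *\<^sub>R (x t + y t)) (\<lambda>t. (1/2) *\<^sub>R (v t + w t))"
  unfolding sobolev_pair_def has_weak_derivative_def set_lebesgue_integral_interval square_integrable_iff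
proof (intro conjI allI impI)
  interpret finite_measure "interval_measure a b" by (rule finite_measure_interval)
  let ?M = "interval_measure a b"
  have x: "continuous_on {a..b} x" and y: "continuous_on {a..b} y"
    and v: "square_integrable_on ?M v" and w: "square_integrable_on ?M w"
    using assms by (auto simp: sobolev_pair_def square_integrable_iff)
  show "continuous_on {a..b} (\<lambda>t. (1/2) *\<^sub>R (x t + y t))" by (intro continuous_intros x y)
  show "square_integrable_on ?M (\<lambda>t. (1/2) *\<^sub>R (v t + w t))"
    by (rule square_integrable_on_scaleR[OF square_integrable_on_add[OF v w]])
  fix \<phi> \<phi>' assume test: "test_function a b \<phi> \<phi>'"
  have cs: "continuous_on {a..b} \<phi>" "continuous_on {a..b} \<phi>'"
    by (rule test_function_continuous[OF test])+
  have half: "(\<integral>t. h t *\<^sub>R (1/2) *\<^sub>R (f t + g t) \<partial>?M) = (1/2) *\<^sub>R ((\<integral>t. h t *\<^sub>R f t \<partial>?M) + (\<integral>t. h t *\<^sub>R g t \<partial>?M))"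
    if "continuous_on {a..b} h" "square_integrable_on ?M f" "square_integrable_on ?M g" for h and f g :: "real \<Rightarrow> 'a"
  proof -
    have i: "integrable ?M (\<lambda>t. h t *\<^sub>R f t)" "integrable ?M (\<lambda>t. h t *\<^sub>R g t)"
      by (intro integrable_scaleR_continuous square_integrable_imp_integrable that)+
    have "(\<integral>t. h t *\<^sub>R (1/2) *\<^sub>R (f t + g t) \<partial>?M) = (\<integral>t. (1/2) *\<^sub>R (h t *\<^sub>R f t + h t *\<^sub>R g t) \<partial>?M)"
      by (intro Bochner_Integration.integral_cong refl) (simp add: algebra_simps)
    also have "\<dots> = (1/2) *\<^sub>R ((\<integral>t. h t *\<^sub>R f t \<partial>?M) + (\<integral>t. h t *\<^sub>R g t \<partial>?M))"
      using i by (simp only: Bochner_Integration.integral_scaleR_right Bochner_Integration.integral_add)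
    finally show ?thesis .
  qed
  have xy: "square_integrable_on ?M x" "square_integrable_on ?M y"
    using continuous_square_integrable x y by (auto simp: square_integrable_iff)
  have "(\<integral>t. \<phi>' t *\<^sub>R x t \<partial>?M) = - (\<integral>t. \<phi> t *\<^sub>R v t \<partial>?M)" "(\<integral>t. \<phi>' t *\<^sub>R y t \<partial>?M) = - (\<integral>t. \<phi> t *\<^sub>R w t \<partial>?M)"
    using assms test by (auto simp: sobolev_pair_def has_weak_derivative_def set_lebesgue_integral_interval)
  then show "(\<integral>t. \<phi>' t *\<^sub>R (1/2) *\<^sub>R (x t + y t) \<partial>?M) = - (\<integral>t. \<phi> t *\<^sub>R (1/2) *\<^sub>R (v t + w t) \<partial>?M)"
    by (simp only: half[OF cs(2) xy] half[OF cs(1) v w] minus_add_distrib scaleR_minus_right[symmetric])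
qed

text \<open>
  A substitute for the weak compactness of balls in the space of square integrable functions. The
  paths at uniform distance at most \<open>e\<close> from \<open>x\<close> form a convex set, whose infimal energy \<open>d\<close> is at most \<open>C\<close>
  and does not decrease as \<open>e\<close> shrinks. The derivatives of near-minimisers for smaller and smaller \<open>e\<close>
  form a Cauchy sequence in mean square: the midpoint of two near-minimisers still belongs to the larger
  of the two sets, so the parallelogram law bounds the energy of their difference. The limit is a weak
  derivative of \<open>x\<close>, to which the paths themselves converge.
\<close>

theorem energy_lower_semicontinuous:
  fixes x :: "real \<Rightarrow> 'a::euclidean_space"
  assumes pair: "\<And>n. sobolev_pair a b (y n) (w n)" and x: "continuous_on {a..b} x"
    and conv: "\<And>e. e > 0 \<Longrightarrow> \<forall>\<^sub>F n in sequentially. \<forall>t\<in>{a..b}. norm (y n t - x t) \<le> e"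
    and C: "\<And>n. energy a b (w n) \<le> C"
  obtains v where "sobolev_pair a b x v" "energy a b v \<le> C"
proof -
  interpret finite_measure "interval_measure a b" by (rule finite_measure_interval)
  define near where "near e = {energy a b v | z v. sobolev_pair a b z v \<and> (\<forall>t\<in>{a..b}. norm (z t - x t) \<le> e)}" for e
  define \<epsilon> where "\<epsilon> n = inverse (real (Suc n))" for n
  have \<epsilon>: "\<epsilon> n > 0" for n by (simp add: \<epsilon>_def)
  have \<epsilon>0: "\<epsilon> \<longlonglongrightarrow> 0" unfolding \<epsilon>_def by (rule LIMSEQ_inverse_real_of_nat)
  have \<epsilon>_dec: "\<epsilon> m \<le> \<epsilon> n" if "n \<le> m" for n m using that by (simp add: \<epsilon>_def)
  define d where "d n = Inf (near (\<epsilon> n))" for n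
  have bdd: "bdd_below (near e)" for e
    by (rule bdd_belowI[of _ 0]) (auto simp: near_def)
  have ex: "\<exists>n. energy a b (w n) \<in> near e" if e: "e > 0" for e
  proof -
    obtain n where "\<forall>t\<in>{a..b}. norm (y n t - x t) \<le> e"
      using conv[OF e] eventually_happens trivial_limit_sequentially by blast
    then have "energy a b (w n) \<in> near e" unfolding near_def using pair[of n] by blast
    then show ?thesis by blast
  qed
  have dC: "d n \<le> C" for n
    using ex[OF \<epsilon>[of n]] C cInf_lower[OF _ bdd] unfolding d_def by (meson order_trans)
  have d_mono: "d n \<le> d m" if "n \<le> m" for n m
    unfolding d_def
  proof (rule cInf_superset_mono)
    show "near (\<epsilon> m) \<noteq> {}" using ex[OF \<epsilon>[of m]] by auto
    show "near (\<epsilon> m) \<subseteq> near (\<epsilon> n)"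
      using \<epsilon>_dec[OF that] unfolding near_def by (blast intro: order_trans)
  qed (rule bdd)
  have "\<exists>z v. sobolev_pair a b z v \<and> (\<forall>t\<in>{a..b}. norm (z t - x t) \<le> \<epsilon> n) \<and> energy a b v < d n + \<epsilon> n" for n
  proof -
    have "near (\<epsilon> n) \<noteq> {}" using ex[OF \<epsilon>[of n]] by auto
    from cInf_lessD[OF this, of "d n + \<epsilon> n"] \<epsilon>[of n] show ?thesis
      by (auto simp: d_def near_def)
  qed
  then obtain z v where zv: "\<And>n. sobolev_pair a b (z n) (v n)"
    and z: "\<And>n t. t \<in> {a..b} \<Longrightarrow> norm (z n t - x t) \<le> \<epsilon> n"
    and v: "\<And>n. energy a b (v n) < d n + \<epsilon> n" by metis
  have sq: "square_integrable_on (interval_measure a b) (v n)" for n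
    using zv by (simp add: sobolev_pair_def square_integrable_iff)
  have close: "energy a b (\<lambda>t. v n t - v m t) \<le> 2 * (d m - d n) + 2 * (\<epsilon> n + \<epsilon> m)" if "n \<le> m" for n m
  proof -
    have "energy a b (\<lambda>t. (1/2) *\<^sub>R (v n t + v m t)) \<in> near (\<epsilon> n)"
      unfolding near_def mem_Collect_eq
    proof (intro exI conjI ballI)
      show "sobolev_pair a b (\<lambda>t. (1/2) *\<^sub>R (z n t + z m t)) (\<lambda>t. (1/2) *\<^sub>R (v n t + v m t))"
        by (rule sobolev_pair_midpoint[OF zv zv])
      fix t assume t: "t \<in> {a..b}"
      have "(1/2) *\<^sub>R (z n t + z m t) - x t = (1/2) *\<^sub>R (z n t - x t) + (1/2) *\<^sub>R (z m t - x t)"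
        by (simp add: algebra_simps flip: scaleR_add_left)
      then have "norm ((1/2) *\<^sub>R (z n t + z m t) - x t) \<le> (1/2) * norm (z n t - x t) + (1/2) * norm (z m t - x t)"
        by (metis norm_triangle_ineq norm_scaleR abs_of_pos half_gt_zero_iff zero_less_one)
      then show "norm ((1/2) *\<^sub>R (z n t + z m t) - x t) \<le> \<epsilon> n"
        using z[OF t, of n] z[OF t, of m] \<epsilon>_dec[OF that] by linarith
    qed (rule refl)
    then have "d n \<le> energy a b (\<lambda>t. (1/2) *\<^sub>R (v n t + v m t))"
      unfolding d_def by (rule cInf_lower[OF _ bdd])
    then show ?thesis
      using integral_parallelogram[OF sq sq, of n m] v[of n] v[of m]
      by (smt (verit))
  qed
  have "Cauchy d"
  proof -
    have "incseq d" using d_mono by (auto simp: incseq_def)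
    then have "convergent d" 
      using incseq_convergent[of d C] dC unfolding convergent_def by metis
    then show ?thesis by (rule convergent_Cauchy)
  qed
  have cauchy: "\<exists>N. \<forall>i\<ge>N. \<forall>j\<ge>N. energy a b (\<lambda>t. v i t - v j t) \<le> e" if e: "e > 0" for e
  proof -
    obtain N1 where N1: "\<And>i j. i \<ge> N1 \<Longrightarrow> j \<ge> N1 \<Longrightarrow> \<bar>d i - d j\<bar> < e / 4"
      using CauchyD[OF \<open>Cauchy d\<close>, of "e/4"] e by auto
    obtain N2 where N2: "\<And>i. i \<ge> N2 \<Longrightarrow> \<epsilon> i < e / 8"
      using order_tendstoD(2)[OF \<epsilon>0, of "e/8"] e by (auto simp: eventually_sequentially)
    have main: "energy a b (\<lambda>t. v i t - v j t) \<le> e" if "i \<ge> max N1 N2" "i \<le> j" for i j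
    proof -
      have "\<bar>d i - d j\<bar> < e / 4" "\<epsilon> i < e / 8" "\<epsilon> j < e / 8"
        using that by (intro N1 N2; simp)+
      then show ?thesis using close[OF that(2)] by argo
    qed
    have "energy a b (\<lambda>t. v i t - v j t) \<le> e" if "i \<ge> max N1 N2" "j \<ge> max N1 N2" for i j
      using main[of i j] main[of j i] that by (cases "i \<le> j") (auto simp: norm_minus_commute)
    then show ?thesis by blast
  qed
  show ?thesis
  proof (rule square_integrable_complete[OF sq cauchy])
    fix u assume u: "square_integrable_on (interval_measure a b) u"
      "(\<lambda>n. energy a b (\<lambda>t. v n t - u t)) \<longlonglongrightarrow> 0"
      "\<And>C. \<forall>\<^sub>F n in sequentially. energy a b (v n) \<le> C \<Longrightarrow> energy a b u \<le> C"
    show ?thesis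
    proof
      show "sobolev_pair a b x u"
        using u by (intro sobolev_pair_limit[OF zv x z \<epsilon>0]) (auto simp: square_integrable_iff)
      show "energy a b u \<le> C"
      proof (rule field_le_epsilon)
        fix e :: real assume e: "e > 0"
        have "\<forall>\<^sub>F n in sequentially. \<epsilon> n < e" using order_tendstoD(2)[OF \<epsilon>0 e] .
        then have "\<forall>\<^sub>F n in sequentially. energy a b (v n) \<le> C + e"
          by eventually_elim (use v dC in \<open>smt (verit)\<close>)
        then show "energy a b u \<le> C + e" by (rule u(3))
      qed
    qed
  qed
qed

section \<open>A chain rule estimate and an improper integral\<close>

lemma C2_on_sphere_continuous:
  assumes "C2_on_sphere V"
  shows "continuous_on (sphere 0 1) V"
  unfolding continuous_on_eq_continuous_within
proof
  fix p :: 'a assume p: "p \<in> sphere 0 1"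
  then obtain U g where U: "open U" "p \<in> U" "C2_on U g" "\<forall>s\<in>U \<inter> sphere 0 1. V s = g s"
    using assms unfolding C2_on_sphere_def by blast
  then obtain g' where "(g has_derivative blinfun_apply (g' p)) (at p)"
    by (auto simp: C2_on_def)
  then have "continuous (at p within sphere 0 1) g"
    using has_derivative_continuous continuous_at_imp_continuous_within by blast
  moreover have "\<forall>\<^sub>F s in at p within sphere 0 1. g s = V s"
    using U by (auto simp: eventually_at_topological)
  moreover have "g p = V p" using U p by auto
  ultimately show "continuous (at p within sphere 0 1) V"
    unfolding continuous_within using tendsto_cong by fastforce
qed

lemma integrable_interval_HK:
  fixes f :: "real \<Rightarrow> 'a::euclidean_space"
  assumes "integrable (interval_measure a b) f"
  shows "f integrable_on {a..b}"
  using set_borel_integral_eq_integral(1)[of "{a<..<b}" f] assms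
  by (simp add: set_integrable_interval integrable_on_open_interval_real)

text \<open>
  A chain rule for functions that are dominated by an indefinite integral, without differentiation
  almost everywhere. On a short interval \<open>f (\<rho> t)\<close> is constant up to \<open>\<eta>\<close>, and the mean value theorem
  gives the estimate with the integrand \<open>(f (\<rho> t) + \<eta>) * w t\<close>. This integrand makes the estimate
  additive under concatenation, so bisection extends it to the whole interval.
\<close>

lemma chain_rule_bound:
  fixes \<rho> w F f :: "real \<Rightarrow> real"
  assumes ab: "a \<le> b" and \<rho>: "continuous_on {a..b} \<rho>" and pos: "\<And>t. t \<in> {a..b} \<Longrightarrow> \<rho> t > 0"
    and w: "w integrable_on {a..b}" "\<And>t. w t \<ge> 0"
    and lip: "\<And>s t. a \<le> s \<Longrightarrow> s \<le> t \<Longrightarrow> t \<le> b \<Longrightarrow> \<bar>\<rho> t - \<rho> s\<bar> \<le> integral {s..t} w"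
    and F: "\<And>u. u > 0 \<Longrightarrow> (F has_real_derivative f u) (at u)"
    and f: "continuous_on {0<..} f" "\<And>u. u > 0 \<Longrightarrow> f u \<ge> 0"
    and g: "(\<lambda>t. f (\<rho> t) * w t) integrable_on {a..b}"
  shows "\<bar>F (\<rho> b) - F (\<rho> a)\<bar> \<le> integral {a..b} (\<lambda>t. f (\<rho> t) * w t)"
proof (rule field_le_epsilon)
  fix e :: real assume e: "e > 0"
  define W where "W = integral {a..b} w"
  have W: "W \<ge> 0" unfolding W_def using w by (intro integral_nonneg) auto
  \<comment> \<open>the \<open>1\<close> avoids a division by zero when \<open>w\<close> has integral zero\<close>
  define \<eta> where "\<eta> = e / (1 + W)"
  have \<eta>: "\<eta> > 0" using e W by (simp add: \<eta>_def)
  define h where "h t = f (\<rho> t) * w t + \<eta> * w t" for t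
  have h: "h integrable_on {a..b}"
    unfolding h_def by (intro integrable_add g integrable_on_mult_right w)
  define P where "P u v \<longleftrightarrow> (a \<le> u \<and> u \<le> v \<and> v \<le> b \<longrightarrow> \<bar>F (\<rho> v) - F (\<rho> u)\<bar> \<le> integral {u..v} h)" for u v
  have contf: "continuous_on {a..b} (\<lambda>t. f (\<rho> t))"
    by (rule continuous_on_compose2[OF f(1) \<rho>]) (use pos in auto)
  have "P a b"
  proof (rule Bolzano[OF ab])
    fix u v z assume P: "P u v" "P v z" "u \<le> v" "v \<le> z"
    show "P u z"
      unfolding P_def
    proof
      assume uz: "a \<le> u \<and> u \<le> z \<and> z \<le> b"
      have "integral {u..z} h = integral {u..v} h + integral {v..z} h"
        using Henstock_Kurzweil_Integration.integral_combine[of u v z h] P uz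
          integrable_on_subinterval[OF h, of u z] by auto
      then show "\<bar>F (\<rho> z) - F (\<rho> u)\<bar> \<le> integral {u..z} h" using P uz unfolding P_def by auto
    qed
  next
    fix \<tau> assume \<tau>: "a \<le> \<tau>" "\<tau> \<le> b"
    then obtain d where d: "d > 0"
      "\<And>t. t \<in> {a..b} \<Longrightarrow> \<bar>t - \<tau>\<bar> < d \<Longrightarrow> \<bar>f (\<rho> t) - f (\<rho> \<tau>)\<bar> < \<eta> / 2"
      using contf \<eta> unfolding continuous_on_iff dist_real_def by (metis atLeastAtMost_iff half_gt_zero)
    show "\<exists>d>0. \<forall>u v. u \<le> \<tau> \<and> \<tau> \<le> v \<and> v - u < d \<longrightarrow> P u v"
    proof (intro exI[of _ d] conjI allI impI d(1))
      fix u v assume uv: "u \<le> \<tau> \<and> \<tau> \<le> v \<and> v - u < d"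
      show "P u v"
        unfolding P_def
      proof
        assume bd: "a \<le> u \<and> u \<le> v \<and> v \<le> b"
        have near: "\<bar>f (\<rho> t) - f (\<rho> \<tau>)\<bar> < \<eta> / 2" if "t \<in> {u..v}" for t
          using d(2)[of t] that uv bd by auto
        have int: "w integrable_on {u..v}" "h integrable_on {u..v}"
          using integrable_on_subinterval[OF w(1)] integrable_on_subinterval[OF h] bd by auto
        have "\<bar>F (\<rho> v) - F (\<rho> u)\<bar> \<le> (f (\<rho> \<tau>) + \<eta> / 2) * \<bar>\<rho> v - \<rho> u\<bar>"
        proof -
          \<comment> \<open>intermediate values between \<open>\<rho> u\<close> and \<open>\<rho> v\<close> are attained on \<open>[u, v]\<close>, where \<open>near\<close> applies\<close>
          have img: "closed_segment (\<rho> u) (\<rho> v) \<subseteq> \<rho> ` {u..v}"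
          proof -
            have "connected (\<rho> ` {u..v})"
              using bd by (intro connected_continuous_image continuous_on_subset[OF \<rho>]) auto
            then show ?thesis
              using bd closed_segment_subset[of "\<rho> u" "\<rho> ` {u..v}" "\<rho> v"]
              by (auto simp: is_interval_connected_1[symmetric] is_interval_convex)
          qed
          have "norm (F (\<rho> v) - F (\<rho> u)) \<le> (f (\<rho> \<tau>) + \<eta> / 2) * norm (\<rho> v - \<rho> u)"
          proof (rule field_differentiable_bound[where S="closed_segment (\<rho> u) (\<rho> v)" and f'=f])
            fix z assume "z \<in> closed_segment (\<rho> u) (\<rho> v)"
            then obtain t where t: "t \<in> {u..v}" "z = \<rho> t" using img by auto
            then have zpos: "z > 0" using pos[of t] bd by auto
            then show "(F has_field_derivative f z) (at z within closed_segment (\<rho> u) (\<rho> v))"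
              using F has_field_derivative_at_within by blast
            show "norm (f z) \<le> f (\<rho> \<tau>) + \<eta> / 2"
              using near[OF t(1)] f(2)[OF zpos] unfolding t(2) real_norm_def by linarith
          qed auto
          then show ?thesis by simp
        qed
        also have "\<dots> \<le> (f (\<rho> \<tau>) + \<eta> / 2) * integral {u..v} w"
          using lip[of u v] bd f(2)[OF pos[of \<tau>]] \<tau> \<eta> by (intro mult_left_mono) auto
        also have "\<dots> = integral {u..v} (\<lambda>t. (f (\<rho> \<tau>) + \<eta> / 2) * w t)" by simp
        also have "\<dots> \<le> integral {u..v} h"
        proof (rule integral_le)
          fix t assume "t \<in> {u..v}"
          then have "f (\<rho> \<tau>) + \<eta> / 2 \<le> f (\<rho> t) + \<eta>" using near[of t] by linarith
          then show "(f (\<rho> \<tau>) + \<eta> / 2) * w t \<le> h t"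
            unfolding h_def using w(2)[of t] by (simp add: mult_right_mono flip: distrib_right)
        qed (use int in \<open>auto intro: integrable_on_mult_right\<close>)
        finally show "\<bar>F (\<rho> v) - F (\<rho> u)\<bar> \<le> integral {u..v} h" .
      qed
    qed
  qed
  then have "\<bar>F (\<rho> b) - F (\<rho> a)\<bar> \<le> integral {a..b} h" using ab by (simp add: P_def)
  also have "\<dots> = integral {a..b} (\<lambda>t. f (\<rho> t) * w t) + \<eta> * W"
    unfolding h_def W_def using g w by (simp add: integral_add integrable_on_mult_right)
  also have "\<eta> * W \<le> e"
    using e W by (simp add: \<eta>_def field_simps)
  finally show "\<bar>F (\<rho> b) - F (\<rho> a)\<bar> \<le> integral {a..b} (\<lambda>t. f (\<rho> t) * w t) + e" by simp
qed

lemma has_integral_powr_abs: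
  fixes k e :: real
  assumes k: "k > 0" and e: "e > -1"
  shows "((\<lambda>t. (k * \<bar>t\<bar>) powr e) has_integral 2 / (k * (e + 1))) {-(1/k)..1/k}"
proof -
  have right: "((\<lambda>t. (k * \<bar>t\<bar>) powr e) has_integral 1 / (k * (e + 1))) {0..1/k}"
  proof -
    have "((\<lambda>t. k powr e * t powr e) has_integral k powr e * ((1/k) powr (e + 1) / (e + 1))) {0..1/k}"
      using k e by (intro has_integral_mult_right has_integral_powr_from_0) auto
    moreover have "k powr e * ((1/k) powr (e + 1) / (e + 1)) = 1 / (k * (e + 1))"
    proof -
      have "k powr e * (1/k) powr (e + 1) = 1 / k" using k by (simp add: powr_divide powr_add)
      then show ?thesis by (metis divide_divide_eq_left times_divide_eq_right)
    qed
    ultimately show ?thesis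
      using k by (auto simp: powr_mult intro: has_integral_eq)
  qed
  then have "((\<lambda>t. (k * \<bar>t\<bar>) powr e) has_integral 1 / (k * (e + 1))) {-(1/k)..0}"
    using has_integral_reflect_real[of "\<lambda>t. (k * \<bar>t\<bar>) powr e" "1 / (k * (e + 1))" "1/k" 0] by simp
  from has_integral_combine[OF _ _ this right] k show ?thesis by simp
qed

section \<open>The action of paths that approach the origin or infinity\<close>

locale homogeneous_potential =
  fixes V :: "'a::euclidean_space \<Rightarrow> real" and \<alpha> Vmin :: real
  assumes V_cont: "continuous_on (sphere 0 1) V"
    and V_ge: "\<And>s. s \<in> sphere 0 1 \<Longrightarrow> Vmin \<le> V s"
    and Vmin_pos: "Vmin > 0" and \<alpha>: "0 < \<alpha>" "\<alpha> < 2"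
begin

text \<open>
  The length of the radial segment from the origin to radius \<open>u\<close> in the Jacobi metric of zero energy for the
  comparison potential \<open>Vmin / norm x powr \<alpha>\<close>; \<open>slope\<close> is its derivative.
\<close>

definition barrier :: "real \<Rightarrow> real" where
  "barrier u = sqrt (2 * Vmin) * u powr (1 - \<alpha> / 2) / (1 - \<alpha> / 2)"

definition slope :: "real \<Rightarrow> real" where
  "slope u = sqrt (2 * Vmin) * u powr (- \<alpha> / 2)"

definition U :: "'a \<Rightarrow> real" where
  "U x = V (x /\<^sub>R norm x) / norm x powr \<alpha>"

lemma potential_U: "x \<noteq> 0 \<Longrightarrow> potential (V, \<alpha>) x = ennreal (U x)"
  by (simp add: potential_def U_def)

lemma U_ge:
  assumes "x \<noteq> 0"
  shows "Vmin * norm x powr (- \<alpha>) \<le> U x"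
proof -
  have "Vmin \<le> V (x /\<^sub>R norm x)" using assms by (intro V_ge) simp
  then have "Vmin / norm x powr \<alpha> \<le> V (x /\<^sub>R norm x) / norm x powr \<alpha>" by (intro divide_right_mono) auto
  then show ?thesis by (simp add: U_def powr_minus_divide)
qed

lemma U_continuous: "continuous_on (- {0}) U"
  unfolding U_def
proof (intro continuous_on_divide)
  show "continuous_on (- {0}) (\<lambda>x::'a. V (x /\<^sub>R norm x))"
    by (rule continuous_on_compose2[OF V_cont]) (auto intro!: continuous_intros left_inverse)
qed (auto intro!: continuous_intros)

lemma barrier_deriv: "u > 0 \<Longrightarrow> (barrier has_real_derivative slope u) (at u)"
  unfolding barrier_def slope_def using \<alpha> by (auto intro!: derivative_eq_intros)

lemma slope_sq: "u > 0 \<Longrightarrow> (slope u)\<^sup>2 = 2 * Vmin * u powr (- \<alpha>)"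
  using Vmin_pos by (simp add: slope_def power_mult_distrib powr_power)

lemma barrier_mono: "0 \<le> u \<Longrightarrow> u \<le> v \<Longrightarrow> barrier u \<le> barrier v"
  unfolding barrier_def using \<alpha> Vmin_pos
  by (intro divide_right_mono mult_left_mono powr_mono2) auto

text \<open>
  Replacing \<open>norm x\<close> by \<open>max (norm x) r\<close> keeps the argument of \<open>slope\<close> away from its singularity and can
  only lower the value of \<open>slope\<close>, so the estimate covers paths through the origin as well. The
  time \<open>\<tau>\<close> splits the path in order to count the descent and the return separately.
\<close>

lemma action_ge_barrier:
  assumes x: "x \<in> H1 a b" and ab: "a \<le> b" and r: "r > 0" and \<tau>: "\<tau> \<in> {a..b}"
  shows "ennreal (\<bar>barrier (max (norm (x \<tau>)) r) - barrier (max (norm (x a)) r)\<bar>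
      + \<bar>barrier (max (norm (x b)) r) - barrier (max (norm (x \<tau>)) r)\<bar>) \<le> action (V, \<alpha>) a b x"
proof -
  interpret finite_measure "interval_measure a b" by (rule finite_measure_interval)
  define v where "v = weak_derivative a b x"
  define \<rho> where "\<rho> t = max (norm (x t)) r" for t
  define g where "g t = slope (\<rho> t) * norm (v t)" for t
  have pair: "sobolev_pair a b x v" unfolding v_def by (rule sobolev_pair_weak_derivative[OF x])
  then have x_cont: "continuous_on {a..b} x" and v: "square_integrable_on (interval_measure a b) v"
    and v': "square_integrable a b v" and weak: "has_weak_derivative a b x v"
    by (auto simp: sobolev_pair_def square_integrable_iff)
  have vint: "integrable (interval_measure a b) v" by (rule square_integrable_imp_integrable[OF v])
  have \<rho>: "continuous_on {a..b} \<rho>" unfolding \<rho>_def by (intro continuous_intros x_cont)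
  have \<rho>pos: "\<rho> t > 0" for t using r by (simp add: \<rho>_def less_max_iff_disj)
  have slope_cont: "continuous_on {0<..} slope"
    unfolding slope_def by (auto intro!: continuous_intros)
  have slope_nonneg: "slope u \<ge> 0" for u by (simp add: slope_def Vmin_pos less_imp_le)
  have slope\<rho>: "continuous_on {a..b} (\<lambda>t. slope (\<rho> t))"
    by (rule continuous_on_compose2[OF slope_cont \<rho>]) (use \<rho>pos in auto)
  have gint: "integrable (interval_measure a b) g"
    using integrable_scaleR_continuous[OF slope\<rho> integrable_norm[OF vint]] by (simp add: g_def[abs_def])
  have g0: "g t \<ge> 0" for t by (simp add: g_def slope_nonneg)
  have gHK: "g integrable_on {a..b}" by (rule integrable_interval_HK[OF gint])
  have wHK: "(\<lambda>t. norm (v t)) integrable_on {a..b}"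
    by (intro integrable_interval_HK integrable_norm vint)
  have vHK: "v integrable_on {a..b}" by (intro integrable_interval_HK vint)
  have chain: "\<bar>barrier (\<rho> t) - barrier (\<rho> s)\<bar> \<le> integral {s..t} g" if st: "a \<le> s" "s \<le> t" "t \<le> b" for s t
    unfolding g_def
  proof (rule chain_rule_bound[OF st(2)])
    show "continuous_on {s..t} \<rho>" using \<rho> st by (auto intro: continuous_on_subset)
    show "(\<lambda>t. norm (v t)) integrable_on {s..t}" "(\<lambda>t. slope (\<rho> t) * norm (v t)) integrable_on {s..t}"
      using integrable_on_subinterval[OF wHK] integrable_on_subinterval[OF gHK] st by (auto simp: g_def[abs_def])
    fix p q assume pq: "s \<le> p" "p \<le> q" "q \<le> t"
    have "\<bar>\<rho> q - \<rho> p\<bar> \<le> norm (x q - x p)"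
      using norm_triangle_ineq3[of "x q" "x p"] unfolding \<rho>_def by linarith
    also have "x q - x p = integral {p..q} v"
      by (rule weak_derivative_FTC[OF x_cont v' weak]) (use pq st in auto)
    also have "norm (integral {p..q} v) \<le> integral {p..q} (\<lambda>t. norm (v t))"
      using integrable_on_subinterval[OF vHK] integrable_on_subinterval[OF wHK] pq st
      by (intro integral_norm_bound_integral) auto
    finally show "\<bar>\<rho> q - \<rho> p\<bar> \<le> integral {p..q} (\<lambda>t. norm (v t))" .
  qed (use \<rho>pos barrier_deriv slope_cont slope_nonneg in auto)
  have "\<bar>barrier (\<rho> \<tau>) - barrier (\<rho> a)\<bar> + \<bar>barrier (\<rho> b) - barrier (\<rho> \<tau>)\<bar> \<le> integral {a..\<tau>} g + integral {\<tau>..b} g"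
    using chain[of a \<tau>] chain[of \<tau> b] \<tau> by auto
  also have "\<dots> = integral {a..b} g"
    using Henstock_Kurzweil_Integration.integral_combine[of a \<tau> b g] \<tau> gHK by auto
  also have "\<dots> = integral\<^sup>L (interval_measure a b) g"
    by (rule integral_interval_eq[OF gint, symmetric])
  finally have "ennreal (\<bar>barrier (\<rho> \<tau>) - barrier (\<rho> a)\<bar> + \<bar>barrier (\<rho> b) - barrier (\<rho> \<tau>)\<bar>)
      \<le> ennreal (integral\<^sup>L (interval_measure a b) g)" by (rule ennreal_leI)
  also have "\<dots> = (\<integral>\<^sup>+t. ennreal (g t) \<partial>interval_measure a b)"
    by (rule nn_integral_eq_integral[OF gint, symmetric]) (simp add: g0)
  also have "\<dots> = (\<integral>\<^sup>+ t \<in> {a<..<b}. ennreal (g t) \<partial>lborel)"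
    by (simp add: nn_integral_restrict_space)
  also have "\<dots> \<le> action (V, \<alpha>) a b x"
    unfolding action_def
  proof (rule nn_integral_mono)
    fix t :: real
    have "ennreal (g t) \<le> ennreal ((norm (v t))\<^sup>2 / 2) + potential (V, \<alpha>) (x t)"
    proof (cases "x t = 0")
      case True
      then show ?thesis by (simp add: potential_def)
    next
      case False
      have "g t \<le> (norm (v t))\<^sup>2 / 2 + (slope (\<rho> t))\<^sup>2 / 2"
        using sum_squares_bound[of "slope (\<rho> t)" "norm (v t)"] by (simp add: g_def field_simps)
      also have "(slope (\<rho> t))\<^sup>2 / 2 = Vmin * \<rho> t powr (- \<alpha>)" using slope_sq[OF \<rho>pos] by simp
      also have "\<dots> \<le> Vmin * norm (x t) powr (- \<alpha>)"
        using False \<alpha> Vmin_pos by (intro mult_left_mono powr_mono2') (auto simp: \<rho>_def)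
      also have "\<dots> \<le> U (x t)" by (rule U_ge[OF False])
      finally have le: "g t \<le> (norm (v t))\<^sup>2 / 2 + U (x t)" by simp
      have "U (x t) \<ge> 0" using U_ge[OF False] Vmin_pos by (smt (verit) mult_nonneg_nonneg powr_ge_zero)
      then show ?thesis using le False by (simp add: potential_U ennreal_leI flip: ennreal_plus)
    qed
    then show "ennreal (g t) * indicator {a<..<b} t \<le> (ennreal ((norm (weak_derivative a b x t))\<^sup>2 / 2)
        + potential (V, \<alpha>) (x t)) * indicator {a<..<b} t"
      by (auto simp: indicator_def v_def)
  qed
  finally show ?thesis by (simp add: \<rho>_def)
qed

lemma barrier_one: "2 * barrier 1 = 4 * sqrt (2 * Vmin) / (2 - \<alpha>)"
  using \<alpha> by (simp add: barrier_def field_simps)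

text \<open>
  The descent from the unit sphere to a small radius \<open>r\<close> and the return cost nearly
  \<open>2 * barrier 1 > C\<close>, and an excursion to a large radius \<open>R\<close> costs at least \<open>barrier R - barrier 1\<close>, which is
  unbounded in \<open>R\<close>.
\<close>

lemma confinement:
  assumes C: "0 \<le> C" "C < 2 * barrier 1"
  obtains r R where "r > 0" "R > 0"
    "\<And>\<xi> \<zeta> a b x t. admissible \<xi> \<zeta> a b x \<Longrightarrow> norm \<xi> = 1 \<Longrightarrow> norm \<zeta> = 1 \<Longrightarrow>
        action (V, \<alpha>) a b x \<le> ennreal C \<Longrightarrow> t \<in> {a..b} \<Longrightarrow> r < norm (x t) \<and> norm (x t) < R"
proof -
  define p where "p = 1 - \<alpha> / 2"
  define A where "A = sqrt (2 * Vmin) / p"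
  have p: "p > 0" and A: "A > 0" using \<alpha> Vmin_pos by (auto simp: p_def A_def)
  have bar: "barrier u = A * u powr p" for u by (simp add: barrier_def A_def p_def)
  \<comment> \<open>chosen so that \<open>barrier (e powr (1 / p)) = A * e\<close> is a quarter of the gap below \<open>2 * barrier 1\<close>\<close>
  define e where "e = (2 * barrier 1 - C) / (4 * A)"
  have e: "e > 0" "2 * (A * e) < 2 * barrier 1 - C" using A C by (auto simp: e_def)
  define r where "r = min 1 (e powr (1 / p))"
  have r: "r > 0" "r \<le> 1" using e by (auto simp: r_def)
  have "r powr p \<le> (e powr (1 / p)) powr p" using r p by (intro powr_mono2) (auto simp: r_def)
  also have "\<dots> = e" using p e by (simp add: powr_powr)
  finally have "A * r powr p \<le> A * e" using A by simp
  then have bar_r: "2 * barrier r < 2 * barrier 1 - C" using e by (simp add: bar)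
  \<comment> \<open>chosen so that \<open>barrier (f powr (1 / p)) = A * f\<close> exceeds \<open>barrier 1 + C\<close>\<close>
  define f where "f = (barrier 1 + C + 1) / A"
  have f: "f > 0" "A * f = barrier 1 + C + 1" using A C by (auto simp: f_def bar)
  define R where "R = max 1 (f powr (1 / p))"
  have R: "R \<ge> 1" by (simp add: R_def)
  have "f = (f powr (1 / p)) powr p" using p f by (simp add: powr_powr)
  also have "\<dots> \<le> R powr p" using p by (intro powr_mono2) (auto simp: R_def)
  finally have "A * f \<le> A * R powr p" using A by simp
  then have bar_R: "barrier R > barrier 1 + C" using f by (simp add: bar)
  show ?thesis
  proof
    show "r > 0" "R > 0" using r R by auto
    fix \<xi> \<zeta> :: 'a and a b x t
    assume adm: "admissible \<xi> \<zeta> a b x" and unit: "norm \<xi> = 1" "norm \<zeta> = 1"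
      and act: "action (V, \<alpha>) a b x \<le> ennreal C" and t: "t \<in> {a..b}"
    have x: "x \<in> H1 a b" "a \<le> b" "norm (x a) = 1" "norm (x b) = 1"
      using adm unit by (auto simp: admissible_def)
    have bound: "\<bar>barrier (max (norm (x t)) q) - barrier (max 1 q)\<bar>
        + \<bar>barrier (max 1 q) - barrier (max (norm (x t)) q)\<bar> \<le> C" if "q > 0" for q
      using order_trans[OF action_ge_barrier[OF x(1,2) that t] act] C x(3,4)
      by (subst (asm) ennreal_le_iff) auto
    show "r < norm (x t) \<and> norm (x t) < R"
    proof (intro conjI; rule ccontr)
      assume "\<not> r < norm (x t)"
      then show False using bound[OF r(1)] bar_r r by (simp add: max_def split: if_splits)
    next
      assume "\<not> norm (x t) < R"
      then have "barrier R \<le> barrier (max (norm (x t)) 1)" using R by (intro barrier_mono) auto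
      then show False using bound[of 1] bar_R by simp
    qed
  qed
qed

section \<open>Juxtaposed homothetic motions\<close>

text \<open>
  The radius \<open>\<rho> t = (rate * \<bar>t\<bar>) powr decay\<close> solves the equation \<open>\<rho>'\<^sup>2 / 2 = Vmin * \<rho> powr (- \<alpha>)\<close> of
  zero energy; it reaches the origin at time \<open>0\<close> and the unit sphere at the times \<open>\<plusminus> 1 / rate\<close>.
\<close>

definition decay :: real where "decay = 2 / (2 + \<alpha>)"
definition rate :: real where "rate = sqrt (2 * Vmin) / decay"

definition homothetic_path :: "'a \<Rightarrow> 'a \<Rightarrow> real \<Rightarrow> 'a" where
  "homothetic_path \<xi> \<zeta> t = (rate * \<bar>t\<bar>) powr decay *\<^sub>R (if t \<le> 0 then \<xi> else \<zeta>)"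

definition homothetic_velocity :: "'a \<Rightarrow> 'a \<Rightarrow> real \<Rightarrow> 'a" where
  "homothetic_velocity \<xi> \<zeta> t =
     (sgn t * sqrt (2 * Vmin) * (rate * \<bar>t\<bar>) powr (decay - 1)) *\<^sub>R (if t \<le> 0 then \<xi> else \<zeta>)"

lemma decay_bounds: "1/2 < decay" "decay < 1" and rate_pos: "rate > 0"
  and decay_eq: "- (decay * \<alpha>) = 2 * decay - 2" and rate_decay: "rate * decay = sqrt (2 * Vmin)"
proof -
  show "1/2 < decay" "decay < 1" "- (decay * \<alpha>) = 2 * decay - 2"
    using \<alpha> by (auto simp: decay_def field_simps)
  then show "rate > 0" "rate * decay = sqrt (2 * Vmin)" using Vmin_pos by (auto simp: rate_def)
qed

lemma homothetic_path_deriv: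
  assumes "t \<noteq> 0"
  shows "(homothetic_path \<xi> \<zeta> has_vector_derivative homothetic_velocity \<xi> \<zeta> t) (at t)"
proof -
  have *: "((\<lambda>t. (rate * (c * t)) powr decay *\<^sub>R z) has_vector_derivative
      (c * sqrt (2 * Vmin) * (rate * (c * t)) powr (decay - 1)) *\<^sub>R z) (at t)" if "c * t > 0" for c and z :: 'a
  proof -
    have "((\<lambda>t. (rate * (c * t)) powr decay) has_real_derivative
        decay * (rate * (c * t)) powr (decay - 1) * (rate * c)) (at t)"
      using that rate_pos by (auto intro!: derivative_eq_intros)
    also have "decay * (rate * (c * t)) powr (decay - 1) * (rate * c)
        = c * (rate * decay) * (rate * (c * t)) powr (decay - 1)" by (simp add: algebra_simps)
    finally have "((\<lambda>t. (rate * (c * t)) powr decay) has_real_derivative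
        c * sqrt (2 * Vmin) * (rate * (c * t)) powr (decay - 1)) (at t)" by (simp only: rate_decay)
    from has_vector_derivative_scaleR[OF this has_vector_derivative_const[of z]]
    show ?thesis by simp
  qed
  show ?thesis
  proof (cases "t > 0")
    case True
    have "((\<lambda>t. (rate * (1 * t)) powr decay *\<^sub>R \<zeta>) has_vector_derivative homothetic_velocity \<xi> \<zeta> t) (at t)"
      using *[of 1 \<zeta>] True by (simp add: homothetic_velocity_def)
    then show ?thesis
      by (rule has_vector_derivative_transform_within_open[of _ _ _ "{0<..}"])
        (use True in \<open>auto simp: homothetic_path_def\<close>)
  next
    case False
    have "((\<lambda>t. (rate * (-1 * t)) powr decay *\<^sub>R \<xi>) has_vector_derivative homothetic_velocity \<xi> \<zeta> t) (at t)"
      using *[of "-1" \<xi>] False assms by (simp add: homothetic_velocity_def)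
    then show ?thesis
      by (rule has_vector_derivative_transform_within_open[of _ _ _ "{..<0}"])
        (use False assms in \<open>auto simp: homothetic_path_def\<close>)
  qed
qed

lemma homothetic_path_continuous: "continuous_on A (homothetic_path \<xi> \<zeta>)"
proof -
  have "isCont (homothetic_path \<xi> \<zeta>) t" for t
  proof (cases "t = 0")
    case False
    from homothetic_path_deriv[OF this] show ?thesis
      by (rule has_vector_derivative_continuous)
  next
    case True
    have "(homothetic_path \<xi> \<zeta> \<longlongrightarrow> 0) (at 0)"
    proof (rule Lim_null_comparison)
      show "\<forall>\<^sub>F t in at 0. norm (homothetic_path \<xi> \<zeta> t) \<le> (rate * \<bar>t\<bar>) powr decay * max (norm \<xi>) (norm \<zeta>)"
        by (rule always_eventually) (auto simp: homothetic_path_def intro!: mult_left_mono)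
      show "((\<lambda>t. (rate * \<bar>t\<bar>) powr decay * max (norm \<xi>) (norm \<zeta>)) \<longlongrightarrow> 0) (at 0)"
        using decay_bounds rate_pos by (auto intro!: tendsto_eq_intros)
    qed
    then show ?thesis using True by (simp add: isCont_def homothetic_path_def)
  qed
  then show ?thesis by (simp add: continuous_at_imp_continuous_on)
qed

lemma homothetic_energy_density:
  assumes "norm \<xi> = 1" "norm \<zeta> = 1" "t \<noteq> 0"
  shows "(norm (homothetic_velocity \<xi> \<zeta> t))\<^sup>2 = 2 * Vmin * (rate * \<bar>t\<bar>) powr (2 * decay - 2)"
proof -
  have "((rate * \<bar>t\<bar>) powr (decay - 1))\<^sup>2 = (rate * \<bar>t\<bar>) powr (2 * decay - 2)"
    using rate_pos assms(3) by (simp add: powr_power algebra_simps)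
  then show ?thesis
    using assms Vmin_pos by (simp add: homothetic_velocity_def power_mult_distrib abs_sgn_eq)
qed

lemma nn_integral_homothetic:
  "(\<integral>\<^sup>+ t \<in> {-(1/rate)<..<1/rate}. ennreal ((rate * \<bar>t\<bar>) powr (2 * decay - 2)) \<partial>lborel)
     = ennreal (2 / (rate * (2 * decay - 1)))"
proof -
  have "((\<lambda>t. (rate * \<bar>t\<bar>) powr (2 * decay - 2)) has_integral 2 / (rate * (2 * decay - 1))) {-(1/rate)<..<1/rate}"
    using has_integral_powr_abs[OF rate_pos, of "2 * decay - 2"] decay_bounds
    by (simp add: has_integral_Icc_iff_Ioo)
  from nn_integral_has_integral_lebesgue[OF _ this] show ?thesis
    by (simp add: ennreal_mult' ennreal_indicator mult.commute)
qed

lemma homothetic_sobolev_pair: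
  assumes "norm \<xi> = 1" "norm \<zeta> = 1"
  shows "sobolev_pair (-(1/rate)) (1/rate) (homothetic_path \<xi> \<zeta>) (homothetic_velocity \<xi> \<zeta>)"
proof (rule sobolev_pair_if_differentiable[where S="{0}"])
  let ?M = "interval_measure (-(1/rate)) (1/rate)"
  have meas: "homothetic_velocity \<xi> \<zeta> \<in> borel_measurable ?M"
    unfolding homothetic_velocity_def[abs_def] by (intro measurable_restrict_space1) measurable
  have "(\<integral>\<^sup>+t. ennreal ((norm (homothetic_velocity \<xi> \<zeta> t))\<^sup>2) \<partial>?M)
     \<le> (\<integral>\<^sup>+t. ennreal (2 * Vmin) * ennreal ((rate * \<bar>t\<bar>) powr (2 * decay - 2)) \<partial>?M)"
  proof (rule nn_integral_mono)
    fix t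
    show "ennreal ((norm (homothetic_velocity \<xi> \<zeta> t))\<^sup>2) \<le> ennreal (2 * Vmin) * ennreal ((rate * \<bar>t\<bar>) powr (2 * decay - 2))"
    proof (cases "t = 0")
      case False
      then show ?thesis using Vmin_pos by (simp add: homothetic_energy_density[OF assms False] ennreal_mult)
    qed (simp add: homothetic_velocity_def)
  qed
  also have "\<dots> = ennreal (2 * Vmin) * (\<integral>\<^sup>+t. ennreal ((rate * \<bar>t\<bar>) powr (2 * decay - 2)) \<partial>?M)"
    by (intro nn_integral_cmult measurable_restrict_space1) measurable
  also have "\<dots> = ennreal (2 * Vmin) * ennreal (2 / (rate * (2 * decay - 1)))"
    using nn_integral_homothetic by (simp add: nn_integral_restrict_space)
  also have "\<dots> < \<infinity>" by (simp add: ennreal_mult_less_top)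
  finally have "integrable ?M (\<lambda>t. (norm (homothetic_velocity \<xi> \<zeta> t))\<^sup>2)"
    using meas by (intro integrableI_bounded) auto
  then show "square_integrable (-(1/rate)) (1/rate) (homothetic_velocity \<xi> \<zeta>)"
    using meas by (simp add: square_integrable_iff square_integrable_on_def)
  show "- (1/rate) \<le> 1/rate" using rate_pos by (simp add: field_simps)
  show "(homothetic_path \<xi> \<zeta> has_vector_derivative homothetic_velocity \<xi> \<zeta> t) (at t)"
    if "t \<in> {-(1/rate)<..<1/rate} - {0}" for t
    using that by (intro homothetic_path_deriv) auto
qed (auto intro: homothetic_path_continuous)

lemma homothetic_path_admissible:
  assumes "norm \<xi> = 1" "norm \<zeta> = 1"
  shows "admissible \<xi> \<zeta> (-(1/rate)) (1/rate) (homothetic_path \<xi> \<zeta>)"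
proof -
  have "homothetic_path \<xi> \<zeta> \<in> H1 (-(1/rate)) (1/rate)"
    using homothetic_sobolev_pair[OF assms] by (auto simp: H1_iff)
  then show ?thesis using rate_pos by (simp add: admissible_def homothetic_path_def field_simps)
qed

lemma homothetic_path_juxtaposed:
  assumes unit: "norm \<xi> = 1" "norm \<zeta> = 1"
  shows "juxtaposed_homothetic \<xi> \<zeta> (-(1/rate)) (1/rate) (homothetic_path \<xi> \<zeta>)"
proof -
  have sq: "square_integrable (-(1/rate)) (1/rate) (homothetic_velocity \<xi> \<zeta>)"
    using homothetic_sobolev_pair[OF assms] by (simp add: sobolev_pair_def)
  have pair: "sobolev_pair c d (homothetic_path \<xi> \<zeta>) (homothetic_velocity \<xi> \<zeta>)"
    if "-(1/rate) \<le> c" "c \<le> d" "d \<le> 1/rate" for c d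
    by (rule sobolev_pair_if_differentiable[where S="{0}"])
      (use that in \<open>auto intro!: homothetic_path_continuous homothetic_path_deriv square_integrable_subinterval[OF sq]\<close>)
  have H1: "homothetic_path \<xi> \<zeta> \<in> H1 (-(1/rate)) 0" "homothetic_path \<xi> \<zeta> \<in> H1 0 (1/rate)"
    using pair[of "-(1/rate)" 0] pair[of 0 "1/rate"] rate_pos by (auto simp: H1_iff)
  have nonzero: "homothetic_path \<xi> \<zeta> t \<noteq> 0" "homothetic_path \<xi> \<zeta> t /\<^sub>R norm (homothetic_path \<xi> \<zeta> t) = (if t \<le> 0 then \<xi> else \<zeta>)"
    if "t \<noteq> 0" for t
    using that unit rate_pos by (auto simp: homothetic_path_def)
  have "homothetic_motion (-(1/rate)) 0 (homothetic_path \<xi> \<zeta>)"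
    unfolding homothetic_motion_def using H1 rate_pos nonzero by (auto intro!: exI[of _ \<xi>])
  moreover have "homothetic_motion 0 (1/rate) (homothetic_path \<xi> \<zeta>)"
    unfolding homothetic_motion_def using H1 rate_pos nonzero by (auto intro!: exI[of _ \<zeta>])
  ultimately show ?thesis
    unfolding juxtaposed_homothetic_def
    using homothetic_path_admissible[OF assms] by (intro exI[of _ 0]) (auto simp: admissible_def homothetic_path_def)
qed

text \<open>
  At zero energy the kinetic and the potential parts of the integrand agree, so the action is twice
  the integral of the potential, a power of time that is integrable because \<open>2 * decay - 2 > -1\<close>.
\<close>

lemma homothetic_path_action:
  assumes unit: "norm \<xi> = 1" "norm \<zeta> = 1" and V: "V \<xi> = Vmin" "V \<zeta> = Vmin"
  shows "action (V, \<alpha>) (-(1/rate)) (1/rate) (homothetic_path \<xi> \<zeta>) = ennreal (4 * sqrt (2 * Vmin) / (2 - \<alpha>))"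
proof -
  let ?x = "homothetic_path \<xi> \<zeta>" and ?I = "{-(1/rate)<..<1/rate}"
  have "AE t in lborel. t \<in> ?I \<longrightarrow> weak_derivative (-(1/rate)) (1/rate) ?x t = homothetic_velocity \<xi> \<zeta> t"
    using sobolev_pair_AE_eq[OF homothetic_sobolev_pair[OF unit]] by (simp add: AE_restrict_space_iff)
  then have "AE t in lborel. (ennreal ((norm (weak_derivative (-(1/rate)) (1/rate) ?x t))\<^sup>2 / 2)
      + potential (V, \<alpha>) (?x t)) * indicator ?I t
    = ennreal (2 * Vmin) * (ennreal ((rate * \<bar>t\<bar>) powr (2 * decay - 2)) * indicator ?I t)"
    using AE_lborel_singleton[of 0]
  proof eventually_elim
    case (elim t)
    have x0: "?x t \<noteq> 0" using elim(2) unit rate_pos by (auto simp: homothetic_path_def)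
    have dir: "?x t /\<^sub>R norm (?x t) = (if t \<le> 0 then \<xi> else \<zeta>)" and nrm: "norm (?x t) = (rate * \<bar>t\<bar>) powr decay"
      using elim(2) unit rate_pos by (auto simp: homothetic_path_def)
    have "U (?x t) = Vmin * (rate * \<bar>t\<bar>) powr (2 * decay - 2)"
    proof -
      have "V (?x t /\<^sub>R norm (?x t)) = Vmin" unfolding dir using V by simp
      then show ?thesis
        unfolding U_def nrm powr_powr decay_eq[symmetric] by (simp add: powr_minus_divide)
    qed
    then have "potential (V, \<alpha>) (?x t) = ennreal (Vmin * (rate * \<bar>t\<bar>) powr (2 * decay - 2))"
      by (simp add: potential_U[OF x0])
    then show ?case
      using elim Vmin_pos homothetic_energy_density[OF unit elim(2)]
      by (auto simp: indicator_def ennreal_mult[symmetric] simp flip: ennreal_plus)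
  qed
  then have "action (V, \<alpha>) (-(1/rate)) (1/rate) ?x
    = (\<integral>\<^sup>+ t. ennreal (2 * Vmin) * (ennreal ((rate * \<bar>t\<bar>) powr (2 * decay - 2)) * indicator ?I t) \<partial>lborel)"
    unfolding action_def by (rule nn_integral_cong_AE)
  also have "\<dots> = ennreal (2 * Vmin) * ennreal (2 / (rate * (2 * decay - 1)))"
    by (subst nn_integral_cmult) (auto simp: nn_integral_homothetic)
  also have "\<dots> = ennreal (2 * Vmin * (2 / (rate * (2 * decay - 1))))"
    using Vmin_pos rate_pos decay_bounds by (intro ennreal_mult[symmetric]) auto
  also have "2 * Vmin * (2 / (rate * (2 * decay - 1))) = 4 * sqrt (2 * Vmin) / (2 - \<alpha>)"
  proof -
    define S where "S = sqrt (2 * Vmin)"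
    have S: "S > 0" "2 * Vmin = S * S" using Vmin_pos by (auto simp: S_def)
    have d: "2 * decay - 1 = (2 - \<alpha>) / (2 + \<alpha>)" using \<alpha> by (simp add: decay_def field_simps)
    have r: "rate = S * (2 + \<alpha>) / 2" by (simp add: rate_def decay_def S_def)
    have q: "rate * (2 * decay - 1) = S * (2 - \<alpha>) / 2" unfolding d r using \<alpha> by (simp add: divide_simps) (simp add: algebra_simps)
    show ?thesis unfolding q S(2) S_def[symmetric] using S(1) \<alpha> by (simp add: field_simps)
  qed
  finally show ?thesis .
qed

section \<open>Existence of minimisers below the collision level\<close>

lemma U_path_continuous:
  assumes "continuous_on {a..b} x" "\<And>t. t \<in> {a..b} \<Longrightarrow> x t \<noteq> 0"
  shows "continuous_on {a..b} (\<lambda>t. U (x t))"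
  by (rule continuous_on_compose2[OF U_continuous assms(1)]) (use assms(2) in auto)

lemma U_pos: "x \<noteq> 0 \<Longrightarrow> U x > 0"
  using U_ge[of x] Vmin_pos by (smt (verit) mult_pos_pos powr_gt_zero norm_eq_zero norm_ge_zero)

text \<open>
  Away from the origin the action is finite and splits into two Bochner integrals, and any weak
  derivative may be used to compute it.
\<close>

lemma action_regular:
  assumes pair: "sobolev_pair a b x v" and nz: "\<And>t. t \<in> {a..b} \<Longrightarrow> x t \<noteq> 0"
  shows "action (V, \<alpha>) a b x = ennreal (energy a b v / 2 + (\<integral>t. U (x t) \<partial>interval_measure a b))"
proof -
  interpret finite_measure "interval_measure a b" by (rule finite_measure_interval)
  let ?M = "interval_measure a b"
  have U: "integrable ?M (\<lambda>t. U (x t))"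
    using pair nz by (intro square_integrable_imp_integrable)
      (auto simp: sobolev_pair_def square_integrable_iff[symmetric] intro!: continuous_square_integrable U_path_continuous)
  have v: "integrable ?M (\<lambda>t. (norm (v t))\<^sup>2 / 2)"
    using pair by (simp add: sobolev_pair_def square_integrable_iff square_integrable_on_def)
  have "action (V, \<alpha>) a b x = (\<integral>\<^sup>+t. (ennreal ((norm (weak_derivative a b x t))\<^sup>2 / 2) + potential (V, \<alpha>) (x t)) \<partial>?M)"
    by (simp add: action_def nn_integral_restrict_space)
  also have "\<dots> = (\<integral>\<^sup>+t. ennreal ((norm (v t))\<^sup>2 / 2 + U (x t)) \<partial>?M)"
  proof (rule nn_integral_cong_AE)
    have "AE t in ?M. t \<in> {a<..<b}" by (simp add: AE_restrict_space_iff)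
    then show "AE t in ?M. ennreal ((norm (weak_derivative a b x t))\<^sup>2 / 2) + potential (V, \<alpha>) (x t)
        = ennreal ((norm (v t))\<^sup>2 / 2 + U (x t))"
      using sobolev_pair_AE_eq[OF pair]
    proof eventually_elim
      case (elim t)
      then have "x t \<noteq> 0" using nz by auto
      with elim show ?case using U_pos[of "x t"] by (simp add: potential_U flip: ennreal_plus)
    qed
  qed
  also have "\<dots> = ennreal (\<integral>t. (norm (v t))\<^sup>2 / 2 + U (x t) \<partial>?M)"
  proof (rule nn_integral_eq_integral)
    show "integrable ?M (\<lambda>t. (norm (v t))\<^sup>2 / 2 + U (x t))" using U v by simp
    have "0 \<le> (norm (v t))\<^sup>2 / 2 + U (x t)" if "t \<in> space ?M" for t
    proof -
      have "x t \<noteq> 0" using that nz by (simp add: space_restrict_space)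
      from U_pos[OF this] show ?thesis by simp
    qed
    then show "AE t in ?M. 0 \<le> (norm (v t))\<^sup>2 / 2 + U (x t)" by (rule AE_I2)
  qed
  also have "(\<integral>t. (norm (v t))\<^sup>2 / 2 + U (x t) \<partial>?M) = energy a b v / 2 + (\<integral>t. U (x t) \<partial>?M)"
    using U v by simp
  finally show ?thesis .
qed

text \<open>
  Moving a path to the time interval \<open>[0, 1]\<close> makes its duration \<open>b - a\<close> an explicit parameter of the action.
\<close>

lemma action_normalise:
  assumes pair: "sobolev_pair a b x v" and ab: "a < b" and nz: "\<And>t. t \<in> {a..b} \<Longrightarrow> x t \<noteq> 0"
  shows "\<exists>w. sobolev_pair 0 1 (\<lambda>s. x ((b - a) * s + a)) w \<and>
    action (V, \<alpha>) a b x = ennreal (energy 0 1 w / (2 * (b - a))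
      + (b - a) * (\<integral>s. U (x ((b - a) * s + a)) \<partial>interval_measure 0 1))"
proof (intro exI conjI)
  let ?w = "\<lambda>s. (b - a) *\<^sub>R v ((b - a) * s + a)"
  have pair': "sobolev_pair ((b - a) * 0 + a) ((b - a) * 1 + a) x v" using pair by simp
  show "sobolev_pair 0 1 (\<lambda>s. x ((b - a) * s + a)) ?w"
    by (rule sobolev_pair_affine(1)[OF _ pair']) (use ab in simp)
  have "energy 0 1 ?w = (b - a) * energy a b v"
    using sobolev_pair_affine(2)[OF _ pair'] ab by simp
  then have e: "energy a b v / 2 = energy 0 1 ?w / (2 * (b - a))" using ab by (simp add: field_simps)
  have u: "(\<integral>t. U (x t) \<partial>interval_measure a b) = (b - a) * (\<integral>s. U (x ((b - a) * s + a)) \<partial>interval_measure 0 1)"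
    using integral_interval_affine[of "b - a" 0 a 1 "\<lambda>t. U (x t)"] ab by simp
  show "action (V, \<alpha>) a b x = ennreal (energy 0 1 ?w / (2 * (b - a))
      + (b - a) * (\<integral>s. U (x ((b - a) * s + a)) \<partial>interval_measure 0 1))"
    using action_regular[OF pair] nz e u by simp
qed

lemma action_rescale:
  assumes pair: "sobolev_pair 0 1 y w" and T: "T > 0" and nz: "\<And>s. s \<in> {0..1} \<Longrightarrow> y s \<noteq> 0"
  shows "(\<lambda>t. y (t / T)) \<in> H1 0 T"
    "action (V, \<alpha>) 0 T (\<lambda>t. y (t / T))
      = ennreal (energy 0 1 w / (2 * T) + T * (\<integral>s. U (y s) \<partial>interval_measure 0 1))"
proof -
  have pair': "sobolev_pair ((1 / T) * 0 + 0) ((1 / T) * T + 0) y w" using pair T by simp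
  have 1: "sobolev_pair 0 T (\<lambda>t. y (t / T)) (\<lambda>t. (1 / T) *\<^sub>R w (t / T))"
    using sobolev_pair_affine(1)[OF _ pair'] T by simp
  then show "(\<lambda>t. y (t / T)) \<in> H1 0 T" by (auto simp: H1_iff)
  have e: "energy 0 T (\<lambda>t. (1 / T) *\<^sub>R w (t / T)) / 2 = energy 0 1 w / (2 * T)"
    using sobolev_pair_affine(2)[OF _ pair'] T by simp
  have u: "(\<integral>t. U (y (t / T)) \<partial>interval_measure 0 T) = T * (\<integral>s. U (y s) \<partial>interval_measure 0 1)"
    using integral_interval_affine[of "1 / T" 0 0 T "\<lambda>s. U (y s)"] T by simp
  have nz': "y (t / T) \<noteq> 0" if "t \<in> {0..T}" for t using that T by (intro nz) auto
  show "action (V, \<alpha>) 0 T (\<lambda>t. y (t / T))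
      = ennreal (energy 0 1 w / (2 * T) + T * (\<integral>s. U (y s) \<partial>interval_measure 0 1))"
    using action_regular[OF 1] nz' e u by (simp add: mult.commute)
qed

lemma potential_part_tendsto:
  fixes y :: "nat \<Rightarrow> real \<Rightarrow> 'a"
  assumes r: "r > 0" and y: "\<And>n. continuous_on {0..1} (y n)" and z: "continuous_on {0..1} z"
    and lo: "\<And>n t. t \<in> {0..1} \<Longrightarrow> r \<le> norm (y n t) \<and> norm (y n t) \<le> R"
    and lim: "\<And>t. t \<in> {0..1} \<Longrightarrow> (\<lambda>n. y n t) \<longlonglongrightarrow> z t"
  shows "(\<lambda>n. \<integral>t. U (y n t) \<partial>interval_measure 0 1) \<longlonglongrightarrow> (\<integral>t. U (z t) \<partial>interval_measure 0 1)"
proof -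
  interpret finite_measure "interval_measure 0 1" by (rule finite_measure_interval)
  have z_ge: "r \<le> norm (z t)" if "t \<in> {0..1}" for t
    by (rule LIMSEQ_le_const[OF tendsto_norm[OF lim[OF that]]]) (use lo that in auto)
  have "compact (cball 0 R - ball (0::'a) r)" by (intro compact_diff) auto
  then have "bounded (U ` (cball 0 R - ball 0 r))"
    by (intro compact_imp_bounded compact_continuous_image continuous_on_subset[OF U_continuous])
      (use r in auto)
  then obtain B where B: "\<And>q. r \<le> norm q \<Longrightarrow> norm q \<le> R \<Longrightarrow> \<bar>U q\<bar> \<le> B"
    unfolding bounded_iff by (force simp: image_iff)
  have ne: "y n t \<noteq> 0" "z t \<noteq> 0" if "t \<in> {0..1}" for n t using lo[OF that, of n] z_ge[OF that] r by auto
  have meas: "(\<lambda>t. U (q t)) \<in> borel_measurable (interval_measure 0 1)"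
    if "continuous_on {0..1} q" "\<And>t. t \<in> {0..1} \<Longrightarrow> q t \<noteq> 0" for q
    using continuous_square_integrable[OF U_path_continuous[OF that]]
    by (simp add: square_integrable_iff square_integrable_on_def)
  show ?thesis
  proof (rule integral_dominated_convergence[where w="\<lambda>_. B"])
    show "AE t in interval_measure 0 1. (\<lambda>n. U (y n t)) \<longlonglongrightarrow> U (z t)"
    proof (rule AE_I2)
      fix t :: real assume "t \<in> space (interval_measure 0 1)"
      then have t: "t \<in> {0..1}" by (simp add: space_restrict_space)
      have "isCont U (z t)"
        using U_continuous ne(2)[OF t] by (simp add: continuous_on_eq_continuous_at open_Compl)
      then show "(\<lambda>n. U (y n t)) \<longlonglongrightarrow> U (z t)" using lim[OF t] isCont_tendsto_compose by blast
    qed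
    show "AE t in interval_measure 0 1. norm (U (y n t)) \<le> B" for n
      by (rule AE_I2) (use lo B in \<open>auto simp: space_restrict_space\<close>)
  qed (use meas y z ne in auto)
qed

text \<open>
  The direct method. Confinement is what makes it work: it bounds the durations of a minimising
  sequence from above and keeps the limit path away from the singularity of the potential.
\<close>

theorem minimiser_exists:
  assumes unit: "norm \<xi> = 1" "norm \<zeta> = 1" "\<xi> \<noteq> \<zeta>"
    and less: "min_action \<xi> \<zeta> (V, \<alpha>) < ennreal (2 * barrier 1)"
  shows "\<exists>a b x. achieves_min \<xi> \<zeta> (V, \<alpha>) a b x"
proof -
  have "min_action \<xi> \<zeta> (V, \<alpha>) < top" using less ennreal_less_top by (rule less_trans)
  then obtain c where c: "c \<ge> 0" "min_action \<xi> \<zeta> (V, \<alpha>) = ennreal c"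
    by (cases "min_action \<xi> \<zeta> (V, \<alpha>)" rule: ennreal_cases) auto
  have "c < 2 * barrier 1" using less c by (simp add: ennreal_less_iff)
  then obtain C where C: "c < C" "C < 2 * barrier 1" using dense by blast
  have C0: "C > 0" using C c by simp
  obtain r R where r: "r > 0" and R: "R > 0"
    and conf: "\<And>\<xi> \<zeta> a b x t. admissible \<xi> \<zeta> a b x \<Longrightarrow> norm \<xi> = 1 \<Longrightarrow> norm \<zeta> = 1 \<Longrightarrow>
        action (V, \<alpha>) a b x \<le> ennreal C \<Longrightarrow> t \<in> {a..b} \<Longrightarrow> r < norm (x t) \<and> norm (x t) < R"
    using confinement[of C] C C0 by (metis less_imp_le)
  define \<epsilon> where "\<epsilon> n = inverse (real (Suc n))" for n
  have \<epsilon>: "\<epsilon> n > 0" for n by (simp add: \<epsilon>_def)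
  have \<epsilon>0: "\<epsilon> \<longlonglongrightarrow> 0" unfolding \<epsilon>_def by (rule LIMSEQ_inverse_real_of_nat)
  \<comment> \<open>a member of the minimising sequence: duration, path rescaled to \<open>[0, 1]\<close>, and its derivative\<close>
  let ?Q = "\<lambda>n T y w. T > 0 \<and> sobolev_pair 0 1 y w \<and> y 0 = \<xi> \<and> y 1 = \<zeta> \<and>
     (\<forall>s\<in>{0..1}. r \<le> norm (y s) \<and> norm (y s) \<le> R) \<and>
     energy 0 1 w / (2 * T) + T * (\<integral>s. U (y s) \<partial>interval_measure 0 1) \<le> min C (c + \<epsilon> n)"
  have "\<exists>T y w. ?Q n T y w" for n
  proof -
    have "min_action \<xi> \<zeta> (V, \<alpha>) < ennreal (min C (c + \<epsilon> n))"
      unfolding c(2) using c(1) C \<epsilon>[of n] by (intro ennreal_lessI) auto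
    then obtain a b x where x: "admissible \<xi> \<zeta> a b x" "action (V, \<alpha>) a b x < ennreal (min C (c + \<epsilon> n))"
      unfolding min_action_def Inf_less_iff by blast
    have ab: "a < b" and pair: "sobolev_pair a b x (weak_derivative a b x)"
      and ends: "x a = \<xi>" "x b = \<zeta>"
      using x by (auto simp: admissible_def sobolev_pair_weak_derivative)
    have "action (V, \<alpha>) a b x \<le> ennreal C"
      using x(2) ennreal_leI[of "min C (c + \<epsilon> n)" C] by (meson less_imp_le min.cobounded1 order_trans)
    note bounds = conf[OF x(1) unit(1,2) this]
    have nz: "x t \<noteq> 0" if "t \<in> {a..b}" for t using bounds[OF that] r by auto
    obtain w where w: "sobolev_pair 0 1 (\<lambda>s. x ((b - a) * s + a)) w"
      "action (V, \<alpha>) a b x = ennreal (energy 0 1 w / (2 * (b - a))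
      + (b - a) * (\<integral>s. U (x ((b - a) * s + a)) \<partial>interval_measure 0 1))"
      using action_normalise[OF pair ab nz] by blast
    have "energy 0 1 w / (2 * (b - a)) + (b - a) * (\<integral>s. U (x ((b - a) * s + a)) \<partial>interval_measure 0 1)
        \<le> min C (c + \<epsilon> n)"
      using less_imp_le[OF x(2)] C0 c(1) \<epsilon>[of n] unfolding w(2)
      by (subst (asm) ennreal_le_iff) auto
    moreover have "(b - a) * s + a \<in> {a..b}" if "s \<in> {0..1}" for s
    proof -
      have "(b - a) * s \<le> (b - a) * 1" "0 \<le> (b - a) * s" using that ab by (auto intro: mult_left_mono)
      then show ?thesis by auto
    qed
    ultimately have "?Q n (b - a) (\<lambda>s. x ((b - a) * s + a)) w"
      using w(1) ab ends bounds by (auto intro: less_imp_le)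
    then show ?thesis by blast
  qed
  then obtain T y w where Q: "\<And>n. ?Q n (T n) (y n) (w n)" by metis
  then have T: "\<And>n. T n > 0" and pair: "\<And>n. sobolev_pair 0 1 (y n) (w n)"
    and ends: "\<And>n. y n 0 = \<xi>" "\<And>n. y n 1 = \<zeta>"
    and bnd: "\<And>n s. s \<in> {0..1} \<Longrightarrow> r \<le> norm (y n s) \<and> norm (y n s) \<le> R"
    and act: "\<And>n. energy 0 1 (w n) / (2 * T n) + T n * (\<integral>s. U (y n s) \<partial>interval_measure 0 1) \<le> min C (c + \<epsilon> n)"
    by blast+
  have ycont: "continuous_on {0..1} (y n)" for n using pair by (simp add: sobolev_pair_def)
  have en0: "energy 0 1 (w n) \<ge> 0" for n by (rule Bochner_Integration.integral_nonneg) simp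
  \<comment> \<open>a lower bound of the potential on the annulus\<close>
  define m where "m = Vmin * R powr (- \<alpha>)"
  have m: "m > 0" using Vmin_pos R by (simp add: m_def)
  have pot: "m \<le> (\<integral>s. U (y n s) \<partial>interval_measure 0 1)" for n
  proof -
    interpret finite_measure "interval_measure 0 1" by (rule finite_measure_interval)
    have ne: "y n s \<noteq> 0" if "s \<in> {0..1}" for s using bnd[OF that, of n] r by auto
    have "m = (\<integral>s. m \<partial>interval_measure 0 1)" using measure_interval[of 0 1] by simp
    also have "\<dots> \<le> (\<integral>s. U (y n s) \<partial>interval_measure 0 1)"
    proof (rule integral_mono)
      show "integrable (interval_measure 0 1) (\<lambda>s. U (y n s))"
        using continuous_square_integrable[OF U_path_continuous[OF ycont ne]]
        by (simp add: square_integrable_iff square_integrable_imp_integrable)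
      fix s :: real assume "s \<in> space (interval_measure 0 1)"
      then have s: "s \<in> {0..1}" by (simp add: space_restrict_space)
      have "R powr (- \<alpha>) \<le> norm (y n s) powr (- \<alpha>)"
        using bnd[OF s, of n] r \<alpha> by (intro powr_mono2') auto
      then have "m \<le> Vmin * norm (y n s) powr (- \<alpha>)"
        unfolding m_def using Vmin_pos by (intro mult_left_mono) auto
      also have "\<dots> \<le> U (y n s)" by (rule U_ge[OF ne[OF s]])
      finally show "m \<le> U (y n s)" .
    qed simp
    finally show ?thesis .
  qed
  have T_hi: "T n \<le> C / m" and en_le: "energy 0 1 (w n) \<le> 2 * T n * C" for n
  proof -
    have 1: "0 \<le> energy 0 1 (w n) / (2 * T n)" using en0 T[of n] by (intro divide_nonneg_pos) auto
    have 2: "T n * m \<le> T n * (\<integral>s. U (y n s) \<partial>interval_measure 0 1)" using pot T[of n] by (intro mult_left_mono) auto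
    have "T n * m \<le> C" using 1 2 act[of n] by linarith
    then show "T n \<le> C / m" using m by (simp add: field_simps)
    have "0 \<le> T n * m" using T[of n] m by simp
    then have "energy 0 1 (w n) / (2 * T n) \<le> C" using 2 act[of n] by linarith
    then show "energy 0 1 (w n) \<le> 2 * T n * C" using T[of n] by (simp add: field_simps)
  qed
  define E1 where "E1 = 2 * (C / m) * C"
  have en_hi: "energy 0 1 (w n) \<le> E1" for n
    using en_le[of n] T_hi[of n] C0 unfolding E1_def by (smt (verit) mult_right_mono)
  define T0 where "T0 = (norm (\<zeta> - \<xi>))\<^sup>2 / (2 * C)"
  have T0: "T0 > 0" using unit C0 by (simp add: T0_def)
  have T_lo: "T0 \<le> T n" for n
  proof -
    have "(norm (\<zeta> - \<xi>))\<^sup>2 \<le> energy 0 1 (w n)"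
      using sobolev_pair_Hoelder[OF pair[of n], of 0 1] ends by simp
    then show ?thesis using en_le[of n] C0 by (simp add: T0_def field_simps)
  qed
  \<comment> \<open>durations and energies converge along \<open>k1\<close>, the rescaled paths along a further subsequence\<close>
  have "seq_compact ({T0..C / m} \<times> {0..E1})"
    by (simp add: compact_Times flip: compact_eq_seq_compact_metric)
  moreover have "\<forall>n. (T n, energy 0 1 (w n)) \<in> {T0..C / m} \<times> {0..E1}"
    using T_lo T_hi en0 en_hi by auto
  ultimately obtain l k1 where l: "l \<in> {T0..C / m} \<times> {0..E1}" and k1: "strict_mono k1"
    and lim1: "((\<lambda>n. (T n, energy 0 1 (w n))) \<circ> k1) \<longlonglongrightarrow> l"
    by (rule seq_compactE)
  obtain T' D where TD: "l = (T', D)" by (cases l)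
  have equi: "\<exists>d>0. \<forall>n t. t \<in> {0..1} \<and> norm (s - t) < d \<longrightarrow> norm (y (k1 n) s - y (k1 n) t) < e"
    if s: "s \<in> {0..1}" and e: "e > 0" for s e
  proof (intro exI conjI allI impI)
    have "E1 \<ge> 0" using en0[of 0] en_hi[of 0] by linarith
    then show "e\<^sup>2 / (E1 + 1) > 0" using e by simp
    fix n t assume t: "t \<in> {0..1} \<and> norm (s - t) < e\<^sup>2 / (E1 + 1)"
    have "(norm (y (k1 n) s - y (k1 n) t))\<^sup>2 \<le> \<bar>s - t\<bar> * energy 0 1 (w (k1 n))"
      using sobolev_pair_Hoelder[OF pair[of "k1 n"], of s t] sobolev_pair_Hoelder[OF pair[of "k1 n"], of t s] s t
      by (cases "s \<le> t") (auto simp: norm_minus_commute)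
    also have "\<dots> \<le> \<bar>s - t\<bar> * (E1 + 1)" using en_hi[of "k1 n"] by (intro mult_left_mono) auto
    also have "\<dots> < e\<^sup>2" using t \<open>E1 \<ge> 0\<close> by (simp add: field_simps)
    finally show "norm (y (k1 n) s - y (k1 n) t) < e" using e by (simp add: power2_less_imp_less)
  qed
  obtain z k2 where z: "continuous_on {0..1} z" and k2: "strict_mono (k2 :: nat \<Rightarrow> nat)"
    and lim2: "\<And>e. 0 < e \<Longrightarrow> \<exists>N. \<forall>n s. n \<ge> N \<and> s \<in> {0..1} \<longrightarrow> norm (y (k1 (k2 n)) s - z s) < e"
  proof (rule Arzela_Ascoli[of "{0..1}" "\<lambda>n. y (k1 n)" R])
    show "compact {0..1::real}" by simp
    show "norm (y (k1 n) s) \<le> R" if "s \<in> {0..1}" for n s using bnd[OF that] by blast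
  qed (erule (1) equi, rule that)
  define k where "k n = k1 (k2 n)" for n
  have k: "strict_mono k" using strict_mono_o[OF k1 k2] by (simp add: k_def[abs_def] o_def)
  have "(\<lambda>n. (T (k n), energy 0 1 (w (k n)))) \<longlonglongrightarrow> (T', D)"
    using LIMSEQ_subseq_LIMSEQ[OF lim1 k2] by (simp add: TD k_def o_def)
  then have Tlim: "(\<lambda>n. T (k n)) \<longlonglongrightarrow> T'" and Elim: "(\<lambda>n. energy 0 1 (w (k n))) \<longlonglongrightarrow> D"
    by (auto dest: tendsto_fst tendsto_snd)
  have unif: "\<forall>\<^sub>F n in sequentially. \<forall>s\<in>{0..1}. norm (y (k n) s - z s) \<le> e" if "e > 0" for e
    using lim2[OF that] unfolding k_def eventually_sequentially by (meson less_imp_le)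
  have ptw: "(\<lambda>n. y (k n) s) \<longlonglongrightarrow> z s" if "s \<in> {0..1}" for s
    by (rule LIMSEQ_I) (use lim2 that in \<open>unfold k_def, meson\<close>)
  have T': "T' > 0" using l TD T0 by auto
  have z_ge: "r \<le> norm (z s)" if "s \<in> {0..1}" for s
    by (rule LIMSEQ_le_const[OF tendsto_norm[OF ptw[OF that]]]) (use bnd that in auto)
  then have z_nz: "z s \<noteq> 0" if "s \<in> {0..1}" for s using that r by force
  \<comment> \<open>lower semicontinuity for a tail of the sequence, whose energies are at most \<open>D + e\<close>\<close>
  have lsc: "\<exists>v. sobolev_pair 0 1 z v \<and> energy 0 1 v \<le> D + e" if e: "e > 0" for e
  proof -
    have "\<forall>\<^sub>F n in sequentially. energy 0 1 (w (k n)) < D + e"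
      using order_tendstoD(2)[OF Elim] e by simp
    then obtain N where N: "\<And>n. n \<ge> N \<Longrightarrow> energy 0 1 (w (k n)) \<le> D + e"
      unfolding eventually_sequentially by (meson less_imp_le)
    have unif': "\<forall>\<^sub>F n in sequentially. \<forall>s\<in>{0..1}. norm (y (k (n + N)) s - z s) \<le> e'" if "e' > 0" for e'
      using unif[OF that] by (rule sequentially_offset)
    obtain v where "sobolev_pair 0 1 z v" "energy 0 1 v \<le> D + e"
      by (rule energy_lower_semicontinuous[of 0 1 "\<lambda>n. y (k (n + N))" "\<lambda>n. w (k (n + N))" z "D + e"])
        (use pair z unif' N in auto)
    then show ?thesis by blast
  qed
  define v where "v = weak_derivative 0 1 z"
  have zH1: "z \<in> H1 0 1" using lsc[of 1] by (auto simp: H1_iff)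
  have zv: "sobolev_pair 0 1 z v" unfolding v_def by (rule sobolev_pair_weak_derivative[OF zH1])
  have vD: "energy 0 1 v \<le> D"
  proof (rule field_le_epsilon)
    fix e :: real assume "e > 0"
    from lsc[OF this] show "energy 0 1 v \<le> D + e" using sobolev_pair_energy unfolding v_def by metis
  qed
  have Plim: "(\<lambda>n. \<integral>s. U (y (k n) s) \<partial>interval_measure 0 1) \<longlonglongrightarrow> (\<integral>s. U (z s) \<partial>interval_measure 0 1)"
    by (rule potential_part_tendsto[OF r _ z _ ptw]) (use ycont bnd in auto)
  have "D / (2 * T') + T' * (\<integral>s. U (z s) \<partial>interval_measure 0 1) \<le> c + 0"
  proof (rule LIMSEQ_le)
    show "(\<lambda>n. energy 0 1 (w (k n)) / (2 * T (k n)) + T (k n) * (\<integral>s. U (y (k n) s) \<partial>interval_measure 0 1))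
        \<longlonglongrightarrow> D / (2 * T') + T' * (\<integral>s. U (z s) \<partial>interval_measure 0 1)"
      using T' by (intro tendsto_intros Tlim Elim Plim) auto
    show "(\<lambda>n. c + \<epsilon> (k n)) \<longlonglongrightarrow> c + 0"
      using LIMSEQ_subseq_LIMSEQ[OF \<epsilon>0 k] by (intro tendsto_intros) (simp add: o_def)
  qed (use act in auto)
  moreover have "energy 0 1 v / (2 * T') \<le> D / (2 * T')" using vD T' by (simp add: divide_right_mono)
  ultimately have "action (V, \<alpha>) 0 T' (\<lambda>t. z (t / T')) \<le> ennreal c"
    using action_rescale(2)[OF zv T'] z_nz by (simp add: ennreal_leI)
  moreover have adm: "admissible \<xi> \<zeta> 0 T' (\<lambda>t. z (t / T'))"
    using action_rescale(1)[OF zv T' z_nz] T' LIMSEQ_unique[OF ptw[of 0]] LIMSEQ_unique[OF ptw[of 1]] ends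
    by (simp add: admissible_def)
  moreover have "min_action \<xi> \<zeta> (V, \<alpha>) \<le> action (V, \<alpha>) 0 T' (\<lambda>t. z (t / T'))"
    unfolding min_action_def using adm by (intro Inf_lower) blast
  ultimately show ?thesis
    unfolding achieves_min_def c(2) using order_antisym by blast
qed

end

section \<open>The alternative\<close>

theorem proposition1p2:
  fixes \<xi>m \<xi>p :: "real ^ 'n" and Vmin \<alpha> :: real and V :: "real ^ 'n \<Rightarrow> real"
  assumes dim: "CARD('n) \<ge> 2"
    and sphere: "\<xi>m \<in> sphere 0 1" "\<xi>p \<in> sphere 0 1" "\<xi>p \<noteq> \<xi>m"
    and Vmin: "Vmin > 0"
    and V: "(V, \<alpha>) \<in> class_P \<xi>m \<xi>p Vmin"
  shows "(min_action \<xi>m \<xi>p (V, \<alpha>) = ennreal (4 * sqrt (2 * Vmin) / (2 - \<alpha>)) \<and>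
          (\<exists>a b x. achieves_min \<xi>m \<xi>p (V, \<alpha>) a b x \<and> juxtaposed_homothetic \<xi>m \<xi>p a b x))
       \<or> (min_action \<xi>m \<xi>p (V, \<alpha>) < ennreal (4 * sqrt (2 * Vmin) / (2 - \<alpha>)) \<and>
          (\<exists>a b x. achieves_min \<xi>m \<xi>p (V, \<alpha>) a b x) \<and>
          (\<exists>r>0. \<forall>a b x. achieves_min \<xi>m \<xi>p (V, \<alpha>) a b x \<longrightarrow> x ` {a..b} \<inter> ball 0 r = {}))"
proof -
  interpret homogeneous_potential V \<alpha> Vmin
    using V Vmin by unfold_locales (auto simp: class_P_def class_S_def intro: C2_on_sphere_continuous)
  let ?M = "4 * sqrt (2 * Vmin) / (2 - \<alpha>)"
  have unit: "norm \<xi>m = 1" "norm \<xi>p = 1" using sphere by auto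
  have V\<xi>: "V \<xi>m = Vmin" "V \<xi>p = Vmin" using V by (auto simp: class_P_def class_S_def)
  note adm = homothetic_path_admissible[OF unit] and act = homothetic_path_action[OF unit V\<xi>]
  have "min_action \<xi>m \<xi>p (V, \<alpha>) \<le> ennreal ?M"
    unfolding min_action_def act[symmetric] using adm by (intro Inf_lower) blast
  then consider "min_action \<xi>m \<xi>p (V, \<alpha>) = ennreal ?M" | "min_action \<xi>m \<xi>p (V, \<alpha>) < ennreal ?M"
    by (auto simp: le_less)
  then show ?thesis
  proof cases
    case 1
    then have "achieves_min \<xi>m \<xi>p (V, \<alpha>) (-(1/rate)) (1/rate) (homothetic_path \<xi>m \<xi>p)"
      using adm act by (simp add: achieves_min_def)
    then show ?thesis using 1 homothetic_path_juxtaposed[OF unit] by blast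
  next
    case 2
    then have less: "min_action \<xi>m \<xi>p (V, \<alpha>) < ennreal (2 * barrier 1)" by (simp only: barrier_one)
    then obtain c where c: "c \<ge> 0" "min_action \<xi>m \<xi>p (V, \<alpha>) = ennreal c"
      by (cases "min_action \<xi>m \<xi>p (V, \<alpha>)" rule: ennreal_cases) auto
    then have "c < 2 * barrier 1" using less by (simp add: ennreal_less_iff)
    then obtain r where r: "r > 0"
      and conf: "\<And>a b x t. admissible \<xi>m \<xi>p a b x \<Longrightarrow> action (V, \<alpha>) a b x \<le> ennreal c \<Longrightarrow> t \<in> {a..b} \<Longrightarrow> r < norm (x t)"
      using confinement[OF c(1)] unit by metis
    have "x ` {a..b} \<inter> ball 0 r = {}" if "achieves_min \<xi>m \<xi>p (V, \<alpha>) a b x" for a b x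
    proof -
      have "r < norm (x t)" if "t \<in> {a..b}" for t
        using conf[of a b x t] that \<open>achieves_min \<xi>m \<xi>p (V, \<alpha>) a b x\<close> by (simp add: achieves_min_def c(2))
      then show ?thesis by (force simp: dist_norm)
    qed
    then show ?thesis using 2 r minimiser_exists[OF unit sphere(3)[symmetric] less] by blast
  qed
qed

end
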